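(* Let $\gamma\in[0,1]$. In the random order model of the $\gamma$-prophet inequality, every algorithm $\textsf{ALG}$ satisfies \[ \textsf{CR}^\gamma(\textsf{ALG})\le(1-\gamma)^{3/2}\big(\sqrt{3-\gamma}-\sqrt{1-\gamma}\big)+\gamma. \] Furthermore, let $p_\gamma$ be the unique solution $p\in(0,1)$ of $1-(1-\gamma)p=\frac{1-p}{-\log p}$. Then the single-threshold algorithm $\textsf{ALG}_\theta$ whose threshold $\theta$ satisfies $\Pr_{X_1\sim F_1,\ldots,X_n\sim F_n}(\max_{i\in[n]}X_i\le\theta)=p_\gamma$ satisfies $\textsf{CR}^\gamma(\textsf{ALG}_\theta)\ge1-(1-\gamma)p_\gamma$.
   Context: The $\gamma$-prophet inequality ($\gamma\in[0,1]$) in the random order model: an instance is a finite tuple $I=(F_1,\ldots,F_n)$ of known distributions on $[0,\infty)$ with finite expectation; independent values $X_i\sim F_i$ are revealed in the order $X_{\pi(1)},\ldots,X_{\pi(n)}$ where $\pi$ is a uniformly random permutation independent of the values. An algorithm is an online stopping rule (decisions depend only on values observed so far and known information) with stopping time $\tau\in\{1,\ldots,n+1\}$; its reward is $\max\{X_{\pi(\tau)},\gamma X_{\pi(\tau-1)},\ldots,\gamma X_{\pi(1)}\}$ (for $\tau=n+1$, $\gamma\max_iX_i$). A single-threshold algorithm with threshold $\theta$ stops at the first observed value exceeding $\theta$. $\textsf{CR}^\gamma(\textsf{ALG})=\inf_I\mathbb{E}[\text{reward}]/\mathbb{E}[\max_iX_i]$ over all instances of all sizes. (The threshold exists for continuous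 distributions; otherwise stochastic tie-breaking is used.)
   Formalization: Existence and uniqueness of p_γ in (0,1) is asserted only for γ<1, since for γ=1 the equation 1=(1-p)/(-log p) has no solution in (0,1); the lower bound is stated for every solution p and so is vacuous at γ=1. *)

theory Defs
  imports "HOL-Probability.Probability"
begin

text \<open>An instance \<open>I\<close> is the list of the distributions \<open>F\<^sub>1, \<dots>, F\<^sub>n\<close>; items and
  time steps are numbered from \<open>1\<close> to \<open>n = length I\<close>.\<close>

type_synonym prophet_inst = "real measure list"

definition prophet_instance :: "prophet_inst \<Rightarrow> bool" where
  "prophet_instance I \<longleftrightarrow> I \<noteq> [] \<and>
     (\<forall>F\<in>set I. prob_space F \<and> sets F = sets borel \<and> (AE x in F. 0 \<le> x) \<and> integrable F (\<lambda>x. x))"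

definition value_space :: "prophet_inst \<Rightarrow> (nat \<Rightarrow> real) measure" where
  "value_space I = (\<Pi>\<^sub>M i\<in>{1..length I}. I ! (i - 1))"

text \<open>Independent uniform seeds, one for each time step, are the source of the internal
  randomisation of an algorithm (in particular of stochastic tie-breaking).\<close>

definition seed_space :: "nat \<Rightarrow> (nat \<Rightarrow> real) measure" where
  "seed_space n = (\<Pi>\<^sub>M t\<in>{1..n}. uniform_measure lborel {0..1})"

text \<open>An outcome is a triple \<open>(\<pi>, X, U)\<close>: arrival order, values of the items, seeds.\<close>

type_synonym outcome = "(nat \<Rightarrow> nat) \<times> (nat \<Rightarrow> real) \<times> (nat \<Rightarrow> real)"

definition outcome_space :: "prophet_inst \<Rightarrow> outcome measure" where
  "outcome_space I =
     uniform_count_measure {\<pi>. \<pi> permutes {1..length I}} \<Otimes>\<^sub>M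
       (value_space I \<Otimes>\<^sub>M seed_space (length I))"

fun revealed :: "outcome \<Rightarrow> nat \<Rightarrow> real" where
  "revealed (\<pi>, X, U) t = X (\<pi> t)"

fun observation :: "outcome \<Rightarrow> nat \<Rightarrow> nat \<times> real \<times> real" where
  "observation (\<pi>, X, U) t = (\<pi> t, X (\<pi> t), U t)"

text \<open>The sigma-algebra generated by what has been observed up to time \<open>t\<close>: the values, the
  items they belong to, and the seeds. It contains the one generated by the values alone, so
  algorithms that are not told which item has arrived are included.\<close>

definition observed_info :: "prophet_inst \<Rightarrow> nat \<Rightarrow> outcome measure" where
  "observed_info I t =
     vimage_algebra (space (outcome_space I))
       (\<lambda>\<omega>. \<lambda>s\<in>{1..min t (length I)}. observation \<omega> s)
       (\<Pi>\<^sub>M s\<in>{1..min t (length I)}. count_space UNIV \<Otimes>\<^sub>M (borel \<Otimes>\<^sub>M borel))"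

text \<open>An algorithm knows the instance, hence is a family of stopping times indexed by it.\<close>

type_synonym stopping_rule = "prophet_inst \<Rightarrow> outcome \<Rightarrow> nat"

definition online_algorithm :: "stopping_rule \<Rightarrow> bool" where
  "online_algorithm ALG \<longleftrightarrow>
     (\<forall>I. prophet_instance I \<longrightarrow>
        stopping_time (observed_info I) (ALG I) \<and>
        (\<forall>\<omega>\<in>space (outcome_space I). ALG I \<omega> \<in> {1..length I + 1}))"

definition max_value :: "prophet_inst \<Rightarrow> (nat \<Rightarrow> real) \<Rightarrow> real" where
  "max_value I X = (MAX i\<in>{1..length I}. X i)"

definition reward :: "real \<Rightarrow> prophet_inst \<Rightarrow> outcome \<Rightarrow> nat \<Rightarrow> real" where
  "reward \<gamma> I \<omega> k =
     (if k \<le> length I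
      then Max (insert (revealed \<omega> k) ((\<lambda>s. \<gamma> * revealed \<omega> s) ` {1..<k}))
      else \<gamma> * max_value I (fst (snd \<omega>)))"

definition expected_reward :: "real \<Rightarrow> stopping_rule \<Rightarrow> prophet_inst \<Rightarrow> real" where
  "expected_reward \<gamma> ALG I = (\<integral>\<omega>. reward \<gamma> I \<omega> (ALG I \<omega>) \<partial>outcome_space I)"

definition expected_max :: "prophet_inst \<Rightarrow> real" where
  "expected_max I = (\<integral>X. max_value I X \<partial>value_space I)"

text \<open>Instances whose values all vanish almost surely give the quotient \<open>0 / 0\<close> and are left out.\<close>

definition CR :: "real \<Rightarrow> stopping_rule \<Rightarrow> real" where
  "CR \<gamma> ALG =
     (INF I\<in>{I. prophet_instance I \<and> 0 < expected_max I}. expected_reward \<gamma> ALG I / expected_max I)"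

text \<open>Threshold \<open>\<theta>\<close> with stochastic tie-breaking: a value equal to \<open>\<theta>\<close> counts as exceeding it if
  its seed exceeds \<open>q\<close>, that is, independently with probability \<open>1 - q\<close>. For \<open>q = 1\<close> this is
  almost surely the plain test \<open>\<theta> < x\<close>.\<close>

definition exceeds :: "real \<Rightarrow> real \<Rightarrow> real \<Rightarrow> real \<Rightarrow> bool" where
  "exceeds \<theta> q x u \<longleftrightarrow> \<theta> < x \<or> (x = \<theta> \<and> q < u)"

fun threshold_time :: "real \<Rightarrow> real \<Rightarrow> nat \<Rightarrow> outcome \<Rightarrow> nat" where
  "threshold_time \<theta> q n (\<pi>, X, U) =
     (LEAST t. 1 \<le> t \<and> (t \<le> n \<longrightarrow> exceeds \<theta> q (X (\<pi> t)) (U t)))"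

definition single_threshold ::
    "(prophet_inst \<Rightarrow> real) \<Rightarrow> (prophet_inst \<Rightarrow> real) \<Rightarrow> stopping_rule" where
  "single_threshold \<theta> q I = threshold_time (\<theta> I) (q I) (length I)"

text \<open>The probability that the maximum of all values does not exceed \<open>\<theta>\<close>, with ties broken by
  independent seeds as above.\<close>

definition prob_max_below :: "prophet_inst \<Rightarrow> real \<Rightarrow> real \<Rightarrow> real" where
  "prob_max_below I \<theta> q =
     measure (value_space I \<Otimes>\<^sub>M seed_space (length I))
       {XU \<in> space (value_space I \<Otimes>\<^sub>M seed_space (length I)).
          \<forall>i\<in>{1..length I}. \<not> exceeds \<theta> q (fst XU i) (snd XU i)}"

lemma space_value_space:
  assumes "prophet_instance I"
  shows "space (value_space I) = extensional {1..length I}"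
proof -
  have "space (I ! (i - 1)) = UNIV" if "i \<in> {1..length I}" for i
  proof -
    have "I ! (i - 1) \<in> set I" using that by (intro nth_mem) auto
    with assms have "sets (I ! (i - 1)) = sets borel" by (auto simp: prophet_instance_def)
    then show ?thesis using sets_eq_imp_space_eq by fastforce
  qed
  then show ?thesis
    by (auto simp: value_space_def space_PiM PiE_def)
qed

lemma prob_space_value_space:
  assumes "prophet_instance I"
  shows "prob_space (value_space I)"
  unfolding value_space_def
proof (rule prob_space_PiM)
  fix i assume "i \<in> {1..length I}"
  then have "I ! (i - 1) \<in> set I" by (intro nth_mem) auto
  with assms show "prob_space (I ! (i - 1))" by (auto simp: prophet_instance_def)
qed

lemma sets_value_space:
  assumes "prophet_instance I"
  shows "sets (value_space I) = sets (\<Pi>\<^sub>M i\<in>{1..length I}. borel)"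
  unfolding value_space_def
proof (rule sets_PiM_cong[OF refl])
  fix i assume "i \<in> {1..length I}"
  then have "I ! (i - 1) \<in> set I" by (intro nth_mem) auto
  with assms show "sets (I ! (i - 1)) = sets borel" by (auto simp: prophet_instance_def)
qed

lemma prob_space_seed: "prob_space (uniform_measure lborel {0..1::real})"
  by (rule prob_space_uniform_measure) auto

lemma prob_space_seed_space: "prob_space (seed_space n)"
  unfolding seed_space_def by (rule prob_space_PiM) (rule prob_space_seed)

lemma sets_seed_space: "sets (seed_space n) = sets (\<Pi>\<^sub>M i\<in>{1..n}. borel)"
  unfolding seed_space_def by (rule sets_PiM_cong) auto

lemma AE_seed_le:
  assumes "i \<in> {1..n}"
  shows "AE U in seed_space n. U i \<le> 1"
  unfolding seed_space_def
proof (rule AE_PiM_component[OF prob_space_seed assms])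
  show "AE x in uniform_measure lborel {0..1}. x \<le> (1::real)"
    by (rule AE_uniform_measureI) auto
qed

lemma prob_max_below_plain:
  assumes I: "prophet_instance I"
  shows "prob_max_below I \<theta> 1 =
    measure (value_space I) {X \<in> space (value_space I). max_value I X \<le> \<theta>}"
proof -
  let ?n = "length I" and ?V = "value_space I" and ?S = "seed_space (length I)"
  interpret V: prob_space ?V by (rule prob_space_value_space[OF I])
  interpret S: prob_space ?S by (rule prob_space_seed_space)
  interpret P: pair_prob_space ?V ?S ..
  let ?B = "{X \<in> space ?V. \<forall>i\<in>{1..?n}. X i \<le> \<theta>}"
  have ne: "{1..?n} \<noteq> {}" using I by (cases I) (auto simp: prophet_instance_def)
  have eqB: "{X \<in> space ?V. max_value I X \<le> \<theta>} = ?B"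
    using ne by (auto simp: max_value_def Max_le_iff)
  note [measurable_cong] = sets_value_space[OF I] sets_seed_space[of ?n]
  have [measurable]: "?B \<in> sets ?V" by measurable
  have ae: "AE XU in ?V \<Otimes>\<^sub>M ?S. \<forall>i\<in>{1..?n}. snd XU i \<le> 1"
  proof (rule P.AE_pair_measure)
    show "AE x in ?V. AE y in ?S. \<forall>i\<in>{1..?n}. snd (x, y) i \<le> 1"
      using AE_seed_le by (auto intro!: AE_finite_allI)
    show "{x \<in> space (?V \<Otimes>\<^sub>M ?S). \<forall>i\<in>{1..?n}. snd x i \<le> 1} \<in> sets (?V \<Otimes>\<^sub>M ?S)"
      by measurable
  qed
  have "prob_max_below I \<theta> 1 = measure (?V \<Otimes>\<^sub>M ?S) (?B \<times> space ?S)"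
    unfolding prob_max_below_def
  proof (rule P.P.finite_measure_eq_AE)
    show "AE x in ?V \<Otimes>\<^sub>M ?S.
       (x \<in> {XU \<in> space (?V \<Otimes>\<^sub>M ?S). \<forall>i\<in>{1..?n}. \<not> exceeds \<theta> 1 (fst XU i) (snd XU i)})
       = (x \<in> ?B \<times> space ?S)"
      using ae AE_space by eventually_elim (auto simp: exceeds_def space_pair_measure; force)
    show "{XU \<in> space (?V \<Otimes>\<^sub>M ?S). \<forall>i\<in>{1..?n}. \<not> exceeds \<theta> 1 (fst XU i) (snd XU i)} \<in> P.P.events"
      unfolding exceeds_def by measurable
    show "?B \<times> space ?S \<in> P.P.events" by measurable
  qed
  also have "\<dots> = measure ?V ?B"
    by (simp add: S.emeasure_pair_measure_Times measure_def S.emeasure_space_1)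
  finally show ?thesis by (simp only: eqB)
qed

lemma threshold_time_le_iff:
  "threshold_time \<theta> q n \<omega> \<le> t \<longleftrightarrow>
     n < t \<or> (\<exists>s\<in>{1..min t n}. exceeds \<theta> q (fst (snd (observation \<omega> s))) (snd (snd (observation \<omega> s))))"
proof -
  obtain \<pi> X U where \<omega>: "\<omega> = (\<pi>, X, U)" by (cases \<omega>)
  let ?P = "\<lambda>t. 1 \<le> t \<and> (t \<le> n \<longrightarrow> exceeds \<theta> q (X (\<pi> t)) (U t))"
  have "(LEAST t. ?P t) \<le> t \<longleftrightarrow> (\<exists>s\<le>t. ?P s)"
  proof
    assume "(LEAST t. ?P t) \<le> t"
    moreover have "?P (LEAST t. ?P t)" by (rule LeastI[of ?P "Suc n"]) auto
    ultimately show "\<exists>s\<le>t. ?P s" by blast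
  next
    assume "\<exists>s\<le>t. ?P s"
    then obtain s where "s \<le> t" "?P s" by blast
    with Least_le[of ?P s] show "(LEAST t. ?P t) \<le> t" by simp
  qed
  also have "\<dots> \<longleftrightarrow> n < t \<or> (\<exists>s\<in>{1..min t n}. exceeds \<theta> q (X (\<pi> s)) (U s))"
  proof -
    have "?P (Suc n)" by simp
    then show ?thesis by (auto intro: exI[of _ "Suc n"])
  qed
  finally show ?thesis by (simp add: \<omega>)
qed

lemma online_algorithm_single_threshold: "online_algorithm (single_threshold \<theta> q)"
  unfolding online_algorithm_def
proof (intro allI impI conjI ballI stopping_timeI)
  fix I t assume I: "prophet_instance I"
  let ?M = "observed_info I t"
  have obs: "(\<lambda>\<omega>. observation \<omega> s) \<in> ?M \<rightarrow>\<^sub>M count_space UNIV \<Otimes>\<^sub>M (borel \<Otimes>\<^sub>M borel)"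
    if s: "s \<in> {1..min t (length I)}" for s
  proof -
    have "(\<lambda>\<omega>. \<lambda>s\<in>{1..min t (length I)}. observation \<omega> s) \<in>
        ?M \<rightarrow>\<^sub>M (\<Pi>\<^sub>M s\<in>{1..min t (length I)}. count_space UNIV \<Otimes>\<^sub>M (borel \<Otimes>\<^sub>M borel))"
      unfolding observed_info_def
      by (rule measurable_vimage_algebra1) (auto simp: space_PiM space_pair_measure)
    from measurable_compose[OF this measurable_component_singleton[OF s]] s
    show ?thesis by simp
  qed
  show "Measurable.pred ?M (\<lambda>\<omega>. single_threshold \<theta> q I \<omega> \<le> t)"
    unfolding single_threshold_def threshold_time_le_iff exceeds_def
  proof (intro pred_intros_logic pred_intros_finite)
    fix s assume "s \<in> {1..min t (length I)}"
    note [measurable] = obs[OF this]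
    show "Measurable.pred ?M (\<lambda>\<omega>. \<theta> I < fst (snd (observation \<omega> s)))"
      "Measurable.pred ?M (\<lambda>\<omega>. fst (snd (observation \<omega> s)) = \<theta> I)"
      "Measurable.pred ?M (\<lambda>\<omega>. q I < snd (snd (observation \<omega> s)))"
      by measurable
  qed auto
next
  fix I \<omega>
  have "\<not> single_threshold \<theta> q I \<omega> \<le> 0" "single_threshold \<theta> q I \<omega> \<le> Suc (length I)"
    unfolding single_threshold_def threshold_time_le_iff by auto
  then show "single_threshold \<theta> q I \<omega> \<in> {1..length I + 1}" by auto
qed

end

theory Submission
  imports Defs "HOL-Real_Asymp.Real_Asymp"
begin

text \<open>
  Upper bound. Take \<open>k\<close> items worth \<open>k\<close> with probability \<open>1/k\<^sup>2\<close> (and \<open>0\<close> otherwise) and one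
  item of constant value \<open>a\<close>, arriving at time \<open>T\<close>. Looking at a fresh rare item is worth \<open>1/k\<close> in
  expectation whatever the past, so up to a martingale the reward is at most
  \<open>max ((T - 1)/k + a) (1 + \<gamma> a)\<close>: stop at the constant item, or look at all the rare ones. Averaging
  over \<open>T\<close> and letting \<open>k\<close> tend to infinity bounds the ratio by
  \<open>(1 + \<gamma> a + (1 - \<gamma>)\<^sup>2 a\<^sup>2 / 2) / (1 + a)\<close>, which is minimal at
  \<open>a = sqrt ((3 - \<gamma>) / (1 - \<gamma>)) - 1\<close>.

  Lower bound. Let \<open>N\<close> be the event that no value exceeds \<open>\<theta>\<close> and \<open>M\<close> the maximum. The algorithm
  earns \<open>\<theta>\<close> off \<open>N\<close>, \<open>\<gamma> M\<close> on \<open>N\<close>, and the excess over \<open>\<theta>\<close> of item \<open>i\<close> whenever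
  no earlier item exceeds \<open>\<theta>\<close>. By AM-GM over the arrival orders the latter has probability at least
  \<open>\<integral>\<^sub>0\<^sup>1 p\<^sup>s ds = (1 - p) / (- ln p)\<close>, while the excess of \<open>M\<close> is at most the sum of the excesses of
  the items. The equation for \<open>p\<close> balances this factor against the loss on \<open>N\<close>.
\<close>

section \<open>Averages over arrival orders\<close>

text \<open>Composing with the transposition of \<open>i\<close> and \<open>j\<close> is a bijection
  of \<open>P\<close> that exchanges the fibres \<open>\<pi> t = i\<close> and
  \<open>\<pi> t = j\<close>, so \<open>\<pi> t\<close> is equidistributed over \<open>J\<close>. A
  general family \<open>P\<close> covers all orders as well as the orders with one prescribed
  arrival.\<close>

lemma sum_transitive_family:
  fixes f :: "'a \<Rightarrow> real"
  assumes "finite P" and "finite J"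
    and in_J: "\<And>\<pi>. \<pi> \<in> P \<Longrightarrow> \<pi> t \<in> J"
    and closed: "\<And>\<pi> i j. \<pi> \<in> P \<Longrightarrow> i \<in> J \<Longrightarrow> j \<in> J \<Longrightarrow> Transposition.transpose i j \<circ> \<pi> \<in> P"
  shows "card J * (\<Sum>\<pi>\<in>P. f (\<pi> t)) = card P * (\<Sum>j\<in>J. f j)"
proof (cases "J = {}")
  case True
  with in_J have "P = {}" by auto
  with True show ?thesis by simp
next
  case False
  then obtain i where i: "i \<in> J" by auto
  define c where "c j = card {\<pi>\<in>P. \<pi> t = j}" for j
  have c: "c j = c i" if j: "j \<in> J" for j
  proof -
    have "bij_betw (\<lambda>\<pi>. Transposition.transpose i j \<circ> \<pi>) {\<pi>\<in>P. \<pi> t = j} {\<pi>\<in>P. \<pi> t = i}"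
      by (rule bij_betw_byWitness[where f' = "\<lambda>\<pi>. Transposition.transpose i j \<circ> \<pi>"])
        (use closed i j in \<open>auto simp: fun_eq_iff\<close>)
    then show ?thesis unfolding c_def by (rule bij_betw_same_card)
  qed
  have sum: "(\<Sum>\<pi>\<in>P. g (\<pi> t)) = c i * (\<Sum>j\<in>J. g j)" for g :: "'a \<Rightarrow> real"
  proof -
    have "(\<Sum>\<pi>\<in>P. g (\<pi> t)) = (\<Sum>j\<in>J. \<Sum>\<pi> | \<pi> \<in> P \<and> \<pi> t = j. g (\<pi> t))"
      by (rule sum.group[symmetric]) (use assms in auto)
    also have "\<dots> = (\<Sum>j\<in>J. c i * g j)"
      by (intro sum.cong refl) (simp add: c[symmetric], simp add: c_def)
    finally show ?thesis by (simp add: sum_distrib_left)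
  qed
  have "real (card P) = c i * card J"
    using sum[of "\<lambda>_. 1"] by simp
  then show ?thesis using sum[of f] by simp
qed

lemma sum_permutes_apply:
  fixes f :: "'a \<Rightarrow> real"
  assumes "finite S" and "t \<in> S"
  shows "card S * (\<Sum>\<pi> | \<pi> permutes S. f (\<pi> t)) = fact (card S) * (\<Sum>j\<in>S. f j)"
proof -
  have "card S * (\<Sum>\<pi> | \<pi> permutes S. f (\<pi> t)) = card {\<pi>. \<pi> permutes S} * (\<Sum>j\<in>S. f j)"
    by (rule sum_transitive_family)
      (use assms in \<open>auto simp: finite_permutations permutes_in_image
          intro!: permutes_compose permutes_swap_id\<close>)
  then show ?thesis by (simp add: card_permutations[OF refl assms(1)])
qed

lemma card_permutes_fixed_value:
  assumes "finite S" and "t \<in> S" and "i \<in> S"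
  shows "real (card S * card {\<pi>. \<pi> permutes S \<and> \<pi> t = i}) = fact (card S)"
proof -
  have "(\<Sum>\<pi> | \<pi> permutes S. of_bool (\<pi> t = i)) = real (card {\<pi>. \<pi> permutes S \<and> \<pi> t = i})"
    using assms by (simp add: finite_permutations Collect_conj_eq)
  moreover have "(\<Sum>j\<in>S. of_bool (j = i)) = (1::real)"
    using assms by (simp add: Collect_conj_eq)
  ultimately show ?thesis
    using sum_permutes_apply[OF assms(1,2), of "\<lambda>j. of_bool (j = i)"] by simp
qed

text \<open>AM-GM over the arrival orders, in the form of the tangent line to \<open>exp\<close>: averaging over the
  orders makes the first-order term vanish.\<close>

lemma sum_prod_before_ge:
  fixes p :: "nat \<Rightarrow> real" and i n t :: nat
  assumes "i \<in> {1..n}" and "t \<in> {1..n}"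
    and pos: "\<And>j. j \<in> {1..n} \<Longrightarrow> 0 < p j" and le1: "\<And>j. j \<in> {1..n} \<Longrightarrow> p j \<le> 1"
  shows "fact n / n * (\<Prod>j\<in>{1..n}. p j) powr ((real t - 1) / (real n - 1))
    \<le> (\<Sum>\<pi> | \<pi> permutes {1..n} \<and> \<pi> t = i. \<Prod>s\<in>{1..<t}. p (\<pi> s))"
proof -
  let ?S = "{1..n}" and ?J = "{1..n} - {i}"
  let ?P = "{\<pi>. \<pi> permutes ?S \<and> \<pi> t = i}"
  define y where "y \<pi> = (\<Sum>s\<in>{1..<t}. ln (p (\<pi> s)))" for \<pi> :: "nat \<Rightarrow> nat"
  define L where "L = (\<Sum>j\<in>?J. ln (p j))"
  \<comment> \<open>The mean of \<open>y\<close> over \<open>?P\<close>: each item other than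
    \<open>i\<close> arrives before time \<open>t\<close> in a fraction
    \<open>(t - 1) / (n - 1)\<close> of the orders. For \<open>n = 1\<close> the quotient is
    \<open>0 / 0 = 0\<close>, and \<open>y\<close> vanishes as well.\<close>
  define m where "m = (real t - 1) / (real n - 1) * L"
  have finP: "finite ?P" by (rule finite_subset[OF _ finite_permutations[of ?S]]) auto
  have S: "\<pi> s \<in> ?S" if "\<pi> \<in> ?P" "s \<in> {1..<t}" for \<pi> s
    using that assms by (auto simp: permutes_in_image simp del: atLeastAtMost_iff) auto
  \<comment> \<open>Given \<open>\<pi> t = i\<close>, the item arriving at time \<open>s\<close> is
    uniform over the other items: transpositions that fix \<open>i\<close> preserve
    \<open>?P\<close>.\<close>
  have J: "(n - 1) * (\<Sum>\<pi>\<in>?P. ln (p (\<pi> s))) = card ?P * L" if s: "s \<in> {1..<t}" for s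
  proof -
    have "card ?J * (\<Sum>\<pi>\<in>?P. ln (p (\<pi> s))) = card ?P * (\<Sum>j\<in>?J. ln (p j))"
    proof (rule sum_transitive_family[OF finP])
      fix \<pi> assume \<pi>: "\<pi> \<in> ?P"
      have "\<pi> s \<noteq> \<pi> t"
        using permutes_inj[of \<pi> ?S] \<pi> s by (auto dest: injD)
      with S[OF \<pi> s] \<pi> show "\<pi> s \<in> ?J" by auto
      fix j k assume "j \<in> ?J" "k \<in> ?J"
      with \<pi> show "Transposition.transpose j k \<circ> \<pi> \<in> ?P"
        by (auto intro!: permutes_compose permutes_swap_id simp: Transposition.transpose_def)
    qed auto
    moreover have "card ?J = n - 1" using assms(1) by simp
    ultimately show ?thesis unfolding L_def by simp
  qed
  have sum_y: "(\<Sum>\<pi>\<in>?P. y \<pi>) = card ?P * m"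
  proof (cases "n = 1")
    case True
    then show ?thesis using assms by (simp add: y_def m_def)
  next
    case False
    with assms have n: "real n - 1 > 0" "real (n - 1) = real n - 1" "real (t - 1) = real t - 1"
      by auto
    have "(\<Sum>\<pi>\<in>?P. y \<pi>) = (\<Sum>s\<in>{1..<t}. \<Sum>\<pi>\<in>?P. ln (p (\<pi> s)))"
      unfolding y_def by (rule sum.swap)
    also have "\<dots> = (\<Sum>s\<in>{1..<t}. card ?P * L / (real n - 1))"
    proof (rule sum.cong[OF refl])
      fix s assume "s \<in> {1..<t}"
      from J[OF this] n show "(\<Sum>\<pi>\<in>?P. ln (p (\<pi> s))) = card ?P * L / (real n - 1)"
        by (simp add: field_simps)
    qed
    also have "\<dots> = card ?P * m" using n by (simp add: m_def field_simps)
    finally show ?thesis .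
  qed
  \<comment> \<open>The left-hand side involves the product over all items, \<open>m\<close> only
    the items other than \<open>i\<close>; the extra factor \<open>p i\<close> is at most 1.\<close>
  have le: "(\<Prod>j\<in>?S. p j) powr ((real t - 1) / (real n - 1)) \<le> exp m"
  proof -
    have prod: "0 < (\<Prod>j\<in>?S. p j)" using pos by (intro prod_pos) auto
    have "ln (\<Prod>j\<in>?S. p j) = (\<Sum>j\<in>?S. ln (p j))"
      using pos by (intro ln_prod) force+
    also have "\<dots> = ln (p i) + L" using assms(1) by (simp add: L_def sum.remove)
    also have "\<dots> \<le> L" using pos[OF assms(1)] le1[OF assms(1)] by simp
    finally have "(real t - 1) / (real n - 1) * ln (\<Prod>j\<in>?S. p j) \<le> m"
      unfolding m_def using assms by (intro mult_left_mono) auto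
    then show ?thesis using prod by (simp add: powr_def)
  qed
  have "real n * card ?P = fact n"
    using card_permutes_fixed_value[of ?S t i] assms by simp
  then have cardP: "real (card ?P) = fact n / n" using assms(1) by (simp add: field_simps)
  have "fact n / n * (\<Prod>j\<in>?S. p j) powr ((real t - 1) / (real n - 1)) \<le> fact n / n * exp m"
    by (intro mult_left_mono le) auto
  also have "\<dots> = (\<Sum>\<pi>\<in>?P. exp m * (1 + (y \<pi> - m)))"
    unfolding sum_distrib_left[symmetric] sum.distrib sum_subtractf sum_y
    using cardP by simp
  also have "\<dots> \<le> (\<Sum>\<pi>\<in>?P. exp (y \<pi>))"
  proof (rule sum_mono)
    fix \<pi>
    have "exp m * (1 + (y \<pi> - m)) \<le> exp m * exp (y \<pi> - m)"
      by (intro mult_left_mono exp_ge_add_one_self) auto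
    then show "exp m * (1 + (y \<pi> - m)) \<le> exp (y \<pi>)" by (simp flip: exp_add)
  qed
  also have "\<dots> = (\<Sum>\<pi>\<in>?P. \<Prod>s\<in>{1..<t}. p (\<pi> s))"
    unfolding y_def using S pos
    by (intro sum.cong refl) (simp add: exp_sum del: atLeastAtMost_iff atLeastLessThan_iff mem_Collect_eq)
  finally show ?thesis .
qed

text \<open>The left-hand side is \<open>\<integral>\<^sub>0\<^sup>1 P\<^sup>s ds\<close>. With \<open>m = n - 1\<close> and \<open>r = P powr (1/m)\<close>, the sum is
  \<open>(m + 1) \<integral>\<^sub>0\<^sup>1 (1 - s + s r)\<^sup>m ds\<close>, and \<open>1 - s + s r \<ge> r\<^sup>s\<close> by convexity.\<close>

lemma mean_powr_ge:
  fixes P :: real and n :: nat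
  assumes "0 < P" and "P < 1" and "0 < n"
  shows "(1 - P) / (- ln P) \<le> (\<Sum>t\<in>{1..n}. P powr ((real t - 1) / (real n - 1))) / n"
proof (cases "n = 1")
  \<comment> \<open>The exponent is \<open>0 / 0 = 0\<close>, so the right-hand side equals
    1.\<close>
  case True
  have "1 - P \<le> - ln P" using ln_le_minus_one[OF assms(1)] by simp
  moreover have "0 < - ln P" using assms by simp
  ultimately have "(1 - P) / (- ln P) \<le> 1" by (subst pos_divide_le_eq) auto
  with True assms show ?thesis by simp
next
  case False
  define m where "m = n - 1"
  have m: "0 < m" "n = Suc m" using False assms(3) by (auto simp: m_def)
  define r where "r = P powr (1 / m)"
  have lnr: "ln r = ln P / m" using assms(1) by (simp add: r_def)
  have r0: "0 < r" using assms(1) by (simp add: r_def)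
  have "ln r < 0" using assms m by (simp add: lnr divide_neg_pos)
  with r0 have r1: "r < 1" by simp
  have pw: "P powr (k / m) = r ^ k" for k :: nat
    using assms(1) m r0 by (simp add: r_def powr_powr flip: powr_realpow)
  have rm: "r ^ m = P" using pw[of m] m assms(1) by simp
  \<comment> \<open>The difference of the integrals from 0 to \<open>s\<close> of
    \<open>(1 - x + x * r) ^ m\<close> and of \<open>P powr x\<close>. It vanishes at 0, and the
    claim is that it is nonnegative at 1.\<close>
  define h where "h s = (1 - (1 - s + s * r) ^ Suc m) / (Suc m * (1 - r)) - (1 - P powr s) / (- ln P)"
    for s :: real
  have "h 0 \<le> h 1"
  proof (rule DERIV_nonneg_imp_nondecreasing[where f = h and a = 0 and b = 1])
    fix s :: real assume s: "0 \<le> s" "s \<le> 1"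
    have "((\<lambda>s. (1 - s + s * r) ^ Suc m) has_real_derivative real (Suc m) * (r - 1) * (1 - s + s * r) ^ m) (at s)"
      by (rule derivative_eq_intros refl | simp del: of_nat_Suc power_Suc)+
    moreover have "((\<lambda>s. P powr s) has_real_derivative P powr s * ln P) (at s)"
      using assms(1) by (auto intro!: derivative_eq_intros)
    ultimately have "(h has_real_derivative
        (0 - real (Suc m) * (r - 1) * (1 - s + s * r) ^ m) / (Suc m * (1 - r)) - (0 - P powr s * ln P) / (- ln P)) (at s)"
      unfolding h_def by (intro DERIV_diff DERIV_cdivide DERIV_const)
    also have "(0 - real (Suc m) * (r - 1) * (1 - s + s * r) ^ m) / (Suc m * (1 - r)) = (1 - s + s * r) ^ m"
    proof -
      have "0 - real (Suc m) * (r - 1) * (1 - s + s * r) ^ m = (1 - s + s * r) ^ m * (Suc m * (1 - r))"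
        by (simp add: algebra_simps)
      then show ?thesis using r1 by simp
    qed
    also have "(0 - P powr s * ln P) / (- ln P) = P powr s" using assms by simp
    finally have der: "(h has_real_derivative (1 - s + s * r) ^ m - P powr s) (at s)" .
    have "exp ((1 - s) * 0 + s * ln r) \<le> (1 - s) * exp 0 + s * exp (ln r)"
      using convex_onD[OF exp_convex, of s 0 "ln r"] s by simp
    then have "r powr s \<le> 1 - s + s * r" using r0 by (simp add: powr_def)
    then have "(r powr s) ^ m \<le> (1 - s + s * r) ^ m" by (intro power_mono) auto
    also have "(r powr s) ^ m = P powr s"
      using r0 by (simp add: rm[symmetric] powr_powr mult.commute flip: powr_realpow)
    finally show "\<exists>y. (h has_real_derivative y) (at s) \<and> 0 \<le> y" using der by auto
  qed simp
  then have "(1 - P) / (- ln P) \<le> (1 - r ^ Suc m) / (Suc m * (1 - r))"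
    using assms(1) by (simp add: h_def)
  also have "\<dots> = (\<Sum>k<Suc m. r ^ k) / n"
    using r1 m sum_gp_strict[of r "Suc m"] by (simp add: mult.commute)
  also have "(\<Sum>k<Suc m. r ^ k) = (\<Sum>t\<in>{1..n}. P powr ((real t - 1) / (real n - 1)))"
    unfolding m(2) by (rule sum.reindex_bij_witness[of _ "\<lambda>t. t - 1" Suc]) (auto simp: pw)
  finally show ?thesis .
qed

text \<open>Clearing the denominator gives \<open>g p = 0\<close>, where \<open>g\<close> vanishes
  at 1 as well. The derivative of \<open>g\<close> is strictly increasing, hence has at most one
  zero, while by Rolle two zeros of \<open>g\<close> below 1 would give it two. Existence:
  \<open>g\<close> tends to infinity at 0 and is negative just left of 1, because
  \<open>g' 1 = c\<close> is positive.\<close>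

lemma threshold_probability_unique:
  fixes c :: real
  assumes "0 < c" and "c \<le> 1"
  shows "\<exists>!p. 0 < p \<and> p < 1 \<and> 1 - c * p = (1 - p) / (- ln p)"
proof -
  define g where "g p = (1 - c * p) * (- ln p) - (1 - p)" for p :: real
  define g' where "g' p = c * ln p - 1 / p + c + 1" for p :: real
  have eq: "1 - c * p = (1 - p) / (- ln p) \<longleftrightarrow> g p = 0" if "0 < p" "p < 1" for p
  proof -
    have "- ln p \<noteq> 0" using that by simp
    then show ?thesis unfolding g_def by (subst eq_divide_eq) auto
  qed
  have der: "(g has_real_derivative g' p) (at p)" if "0 < p" for p
    unfolding g_def g'_def using that
    by (auto intro!: derivative_eq_intros simp: field_simps)
  have diff: "g differentiable (at p)" if "0 < p" for p
    using der[OF that] by (auto simp: real_differentiable_def)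
  have mono: "g' x < g' y" if "0 < x" "x < y" for x y
    unfolding g'_def using that assms(1)
    by (intro add_strict_right_mono) (smt (verit) ln_less_cancel_iff mult_strict_left_mono frac_less2)
  have cont: "continuous_on {x..y} g" if "0 < x" for x y
    using that der by (intro DERIV_continuous_on[of _ _ g'])
      (auto intro: has_field_derivative_at_within)
  have rolle: False if xy: "0 < x" "x < y" "y < 1" "g x = 0" "g y = 0" for x y
  proof -
    have "\<exists>z. x < z \<and> z < y \<and> (g has_real_derivative 0) (at z)"
      using xy by (intro Rolle cont diff) auto
    then obtain z where z: "x < z" "z < y" "(g has_real_derivative 0) (at z)" by blast
    have "\<exists>w. y < w \<and> w < 1 \<and> (g has_real_derivative 0) (at w)"
      using xy by (intro Rolle cont diff) (auto simp: g_def)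
    then obtain w where w: "y < w" "w < 1" "(g has_real_derivative 0) (at w)" by blast
    have "g' z = 0" "g' w = 0"
      using DERIV_unique[OF der z(3)] DERIV_unique[OF der w(3)] xy z w by auto
    moreover have "g' z < g' w" using xy z w by (intro mono) auto
    ultimately show False by simp
  qed
  have "\<exists>p. 0 < p \<and> p < 1 \<and> g p = 0"
  proof -
    have "(g has_real_derivative g' 1) (at 1)" by (rule der) simp
    moreover have "0 < g' 1" using assms by (simp add: g'_def)
    ultimately obtain d where d: "0 < d" "\<And>h. 0 < h \<Longrightarrow> h < d \<Longrightarrow> g (1 - h) < g 1"
      using DERIV_pos_inc_left by blast
    \<comment> \<open>The minimum keeps \<open>y\<close> positive and inside the range where
      \<open>g\<close> lies below \<open>g 1 = 0\<close>.\<close>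
    define y where "y = 1 - min (d / 2) (1 / 2)"
    have y: "0 < y" "y < 1" "g y < 0"
      using d(1) d(2)[of "min (d / 2) (1 / 2)"] by (auto simp: y_def g_def)
    have "filterlim g at_top (at_right 0)"
      unfolding g_def using assms by real_asymp
    then have "eventually (\<lambda>x. 0 \<le> g x) (at_right 0)"
      by (simp add: filterlim_at_top)
    moreover have "eventually (\<lambda>x. x \<in> {0<..<y}) (at_right 0)"
      using y by (intro eventually_at_right_real)
    ultimately have "eventually (\<lambda>x. 0 \<le> g x \<and> x \<in> {0<..<y}) (at_right 0)"
      by eventually_elim auto
    then obtain x where x: "0 \<le> g x" "0 < x" "x < y"
      using eventually_happens'[of "at_right (0::real)"] by fastforce
    then have "\<exists>z\<ge>x. z \<le> y \<and> g z = 0"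
      using y cont by (intro IVT2') auto
    then obtain z where "x \<le> z" "z \<le> y" "g z = 0" by auto
    then show ?thesis using x y by (intro exI[of _ z]) auto
  qed
  moreover have "x = y" if "0 < x \<and> x < 1 \<and> g x = 0" "0 < y \<and> y < 1 \<and> g y = 0" for x y
    using rolle[of x y] rolle[of y x] that by (cases x y rule: linorder_cases) auto
  ultimately show ?thesis using eq by (metis (no_types, lifting))
qed

text \<open>Lets a quantity that involves only the time steps up to \<open>t\<close> be written as a
  product over all time steps, the form that \<open>nn_integral_prod_steps\<close> requires, and be
  read back after integration.\<close>

lemma prod_upto_split:
  fixes g :: "nat \<Rightarrow> 'a :: comm_monoid_mult"
  assumes "t \<in> {1..n}"
  shows "(\<Prod>s\<in>{1..n}. if s < t then g s else if s = t then b else 1) = (\<Prod>s\<in>{1..<t}. g s) * b"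
proof -
  have "{1..n} = {1..<t} \<union> ({t} \<union> {t<..n})" using assms by auto
  then have "(\<Prod>s\<in>{1..n}. if s < t then g s else if s = t then b else 1)
      = (\<Prod>s\<in>{1..<t}. if s < t then g s else if s = t then b else 1)
        * (\<Prod>s\<in>{t} \<union> {t<..n}. if s < t then g s else if s = t then b else 1)"
    by (simp only:) (rule prod.union_disjoint, auto)
  also have "(\<Prod>s\<in>{t} \<union> {t<..n}. if s < t then g s else if s = t then b else 1) = b"
    by (subst prod.union_disjoint) auto
  finally show ?thesis by simp
qed

section \<open>The outcome space\<close>

locale prophet =
  fixes I :: prophet_inst
  assumes inst: "prophet_instance I"
begin

declare One_nat_def [simp del]

abbreviation "n \<equiv> length I"
abbreviation "Q \<equiv> value_space I \<Otimes>\<^sub>M seed_space n"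
abbreviation "seed \<equiv> uniform_measure lborel {0..1::real}"
abbreviation "orders \<equiv> {\<pi>. \<pi> permutes {1..n}}"

text \<open>The junk value outside \<open>{1..n}\<close> makes every \<open>item i\<close> a probability space.\<close>

definition item :: "nat \<Rightarrow> real measure" where
  "item i = (if i \<in> {1..n} then I ! (i - 1) else return borel 0)"

lemma n_pos: "0 < n"
  using inst by (auto simp: prophet_instance_def)

lemma item_in: "i \<in> {1..n} \<Longrightarrow> item i \<in> set I"
  by (auto simp: item_def)

lemma prob_space_item: "prob_space (item i)"
  using inst item_in[of i] prob_space_return[of 0 "borel :: real measure"]
  by (cases "i \<in> {1..n}") (auto simp: prophet_instance_def item_def)

lemma sets_item [measurable_cong]: "sets (item i) = sets borel"
  using inst item_in[of i]
  by (cases "i \<in> {1..n}") (auto simp: prophet_instance_def item_def)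

lemma space_item [simp]: "space (item i) = UNIV"
  using sets_eq_imp_space_eq[OF sets_item] by simp

lemma item_nonneg: "i \<in> {1..n} \<Longrightarrow> AE x in item i. 0 \<le> x"
  using inst item_in[of i] by (auto simp: prophet_instance_def)

lemma integrable_item: "i \<in> {1..n} \<Longrightarrow> integrable (item i) (\<lambda>x. x)"
  using inst item_in[of i] by (auto simp: prophet_instance_def)

lemma value_space_item: "value_space I = PiM {1..n} item"
  unfolding value_space_def by (rule PiM_cong) (auto simp: item_def)

sublocale item: product_prob_space item "{1..n}"
  using prob_space_item by (auto simp: product_prob_space_def product_prob_space_axioms_def
      product_sigma_finite_def intro: prob_space_imp_sigma_finite)

sublocale seed: product_prob_space "\<lambda>_. seed" "{1..n}"
  using prob_space_seed by (auto simp: product_prob_space_def product_prob_space_axioms_def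
      product_sigma_finite_def intro: prob_space_imp_sigma_finite)

sublocale V: prob_space "value_space I"
  by (rule prob_space_value_space[OF inst])

sublocale S: prob_space "seed_space n"
  by (rule prob_space_seed_space)

sublocale Q: pair_prob_space "value_space I" "seed_space n" ..

lemmas sets_spaces [measurable_cong] = sets_value_space[OF inst] sets_seed_space[of n]

lemma finite_orders: "finite orders"
  by (simp add: finite_permutations)

lemma prob_space_orders: "prob_space (uniform_count_measure orders)"
  by (rule prob_space_uniform_count_measure) (auto simp: finite_permutations intro: permutes_id)

lemma permutes_in: "\<pi> permutes {1..n} \<Longrightarrow> t \<in> {1..n} \<Longrightarrow> \<pi> t \<in> {1..n}"
  by (simp only: permutes_in_image)

lemma space_outcome_space: "space (outcome_space I) = orders \<times> space Q"
  by (simp add: outcome_space_def space_pair_measure space_uniform_count_measure)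

text \<open>Reduces the work to one fixed arrival order at a time: the orders form a finite set, so
  integrability on each slice suffices, and the integral is the average over the
  \<open>fact n\<close> orders.\<close>

lemma
  fixes f :: "outcome \<Rightarrow> real"
  assumes int: "\<And>\<pi>. \<pi> permutes {1..n} \<Longrightarrow> integrable Q (\<lambda>z. f (\<pi>, z))"
  shows integrable_outcome_space: "integrable (outcome_space I) f"
    and integral_outcome_space:
      "(\<integral>\<omega>. f \<omega> \<partial>outcome_space I) = (\<Sum>\<pi>\<in>orders. \<integral>z. f (\<pi>, z) \<partial>Q) / fact n"
proof -
  let ?C = "uniform_count_measure orders"
  interpret C: prob_space ?C by (rule prob_space_orders)
  interpret P: pair_prob_space ?C Q ..
  have C: "integrable ?C g" for g :: "(nat \<Rightarrow> nat) \<Rightarrow> real"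
    unfolding uniform_count_measure_def
    by (rule integrable_point_measure_finite[OF finite_orders])
  have "f \<in> borel_measurable (count_space orders \<Otimes>\<^sub>M Q)"
    by (rule measurable_pair_measure_countable1)
      (use int finite_orders in \<open>auto intro: countable_finite borel_measurable_integrable\<close>)
  also have "borel_measurable (count_space orders \<Otimes>\<^sub>M Q) = borel_measurable (?C \<Otimes>\<^sub>M Q)"
    by (intro measurable_cong_sets sets_pair_measure_cong)
      (auto simp: uniform_count_measure_def sets_point_measure)
  finally have f: "f \<in> borel_measurable (?C \<Otimes>\<^sub>M Q)" .
  have "integrable (?C \<Otimes>\<^sub>M Q) f"
    by (rule P.Fubini_integrable[OF f C])
      (use int in \<open>auto intro!: AE_I2 simp: space_uniform_count_measure\<close>)
  then show "integrable (outcome_space I) f"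
    "(\<integral>\<omega>. f \<omega> \<partial>outcome_space I) = (\<Sum>\<pi>\<in>orders. \<integral>z. f (\<pi>, z) \<partial>Q) / fact n"
    by (simp_all add: outcome_space_def P.integral_fst'[symmetric]
        integral_uniform_count_measure[OF finite_orders] card_permutations)
qed

lemma distr_value_outcome_space:
  "distr (outcome_space I) Q snd = Q"
proof (rule measure_eqI)
  interpret C: prob_space "uniform_count_measure orders" by (rule prob_space_orders)
  fix A assume "A \<in> sets (distr (outcome_space I) Q snd)"
  then have [measurable]: "A \<in> sets Q" by simp
  have "snd -` A \<inter> space (outcome_space I) = space (uniform_count_measure orders) \<times> A"
    using sets.sets_into_space[of A Q]
    by (auto simp: outcome_space_def space_pair_measure)
  then show "emeasure (distr (outcome_space I) Q snd) A = emeasure Q A"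
    by (simp add: outcome_space_def emeasure_distr Q.P.emeasure_pair_measure_Times C.emeasure_space_1)
qed simp

lemma AE_Q: "AE X in value_space I. P X \<Longrightarrow> AE z in Q. P (fst z)"
  by (rule AE_distrD[OF measurable_fst]) (subst S.distr_pair_fst)

lemma AE_outcome_space:
  assumes "AE z in Q. P z"
  shows "AE \<omega> in outcome_space I. P (snd \<omega>)"
proof (rule AE_distrD[where P = P])
  show "snd \<in> measurable (outcome_space I) Q" by (simp add: outcome_space_def)
  show "AE z in distr (outcome_space I) Q snd. P z"
    using assms by (subst distr_value_outcome_space)
qed

lemma AE_values:
  assumes "\<And>i. i \<in> {1..n} \<Longrightarrow> AE x in item i. P i x"
  shows "AE X in value_space I. \<forall>i\<in>{1..n}. P i (X i)"
  unfolding value_space_item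
  by (intro AE_finite_allI) (use assms prob_space_item in \<open>auto intro: AE_PiM_component\<close>)

lemma measurable_component:
  "i \<in> {1..n} \<Longrightarrow> (\<lambda>X. X i) \<in> borel_measurable (value_space I)"
  "i \<in> {1..n} \<Longrightarrow> (\<lambda>U. U i) \<in> borel_measurable (seed_space n)"
  by measurable

lemma
  fixes h :: "real \<Rightarrow> real"
  assumes "i \<in> {1..n}" and "integrable (item i) h"
  shows integrable_component: "integrable Q (\<lambda>z. h (fst z i))"
    and integral_component: "(\<integral>z. h (fst z i) \<partial>Q) = (\<integral>x. h x \<partial>item i)"
proof -
  have "distr (value_space I) (item i) (\<lambda>X. X i) = item i"
    unfolding value_space_item by (rule distr_PiM_component[OF prob_space_item assms(1)])
  then have d: "distr Q (item i) (\<lambda>z. fst z i) = item i"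
    using distr_distr[of "\<lambda>X. X i" "value_space I" "item i" fst Q] assms(1)
    by (simp add: S.distr_pair_fst comp_def)
  have m: "(\<lambda>z. fst z i) \<in> measurable Q (item i)" using assms(1) by measurable
  show "integrable Q (\<lambda>z. h (fst z i))"
    using integrable_distr[OF m, of h] assms(2) d by simp
  show "(\<integral>z. h (fst z i) \<partial>Q) = (\<integral>x. h x \<partial>item i)"
    using integral_distr[OF m borel_measurable_integrable[OF assms(2)]] d by simp
qed

text \<open>Independence of the time steps under a fixed order. Values are indexed by items but
  seeds by time: the seeds are integrated out first, then the product over times is reindexed by
  \<open>inv \<pi>\<close> as a product over items, where the product measure factors, and finally
  reindexed back.\<close>

lemma nn_integral_prod_steps:
  fixes \<phi> :: "nat \<Rightarrow> real \<Rightarrow> real \<Rightarrow> ennreal"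
  assumes \<pi>: "\<pi> permutes {1..n}"
    and [measurable]: "\<And>t. case_prod (\<phi> t) \<in> borel_measurable (borel \<Otimes>\<^sub>M borel)"
  shows "(\<integral>\<^sup>+z. (\<Prod>t\<in>{1..n}. \<phi> t (fst z (\<pi> t)) (snd z t)) \<partial>Q)
    = (\<Prod>t\<in>{1..n}. \<integral>\<^sup>+x. \<integral>\<^sup>+u. \<phi> t x u \<partial>seed \<partial>item (\<pi> t))"
proof -
  interpret seed: prob_space seed by (rule prob_space_seed)
  define \<psi> where "\<psi> t x = (\<integral>\<^sup>+u. \<phi> t x u \<partial>seed)" for t x
  have [measurable]: "\<psi> t \<in> borel_measurable borel" for t
    unfolding \<psi>_def by measurable
  have "\<phi> t x \<in> borel_measurable borel" for t x
    using measurable_compose[OF measurable_Pair1' assms(2)] by simp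
  also have "borel_measurable borel = borel_measurable seed"
    by (rule measurable_cong_sets) auto
  finally have seed_meas: "\<phi> t x \<in> borel_measurable seed" for t x .
  note in_n = permutes_in[OF \<pi>]
  have [measurable]: "(\<lambda>z. fst z (\<pi> t)) \<in> borel_measurable Q"
    "(\<lambda>X. X (\<pi> t)) \<in> borel_measurable (value_space I)" if "t \<in> {1..n}" for t
    using in_n[OF that] by measurable
  have "(\<integral>\<^sup>+z. (\<Prod>t\<in>{1..n}. \<phi> t (fst z (\<pi> t)) (snd z t)) \<partial>Q)
      = (\<integral>\<^sup>+X. \<integral>\<^sup>+U. (\<Prod>t\<in>{1..n}. \<phi> t (X (\<pi> t)) (U t)) \<partial>seed_space n \<partial>value_space I)"
    by (subst S.nn_integral_fst[symmetric]) (simp_all add: case_prod_beta')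
  also have "\<dots> = (\<integral>\<^sup>+X. (\<Prod>t\<in>{1..n}. \<psi> t (X (\<pi> t))) \<partial>value_space I)"
    unfolding seed_space_def \<psi>_def
    by (intro nn_integral_cong seed.product_nn_integral_prod seed_meas) simp
  also have "\<dots> = (\<integral>\<^sup>+X. (\<Prod>i\<in>{1..n}. \<psi> (inv \<pi> i) (X i)) \<partial>value_space I)"
    by (intro nn_integral_cong, subst prod.permute[OF \<pi>])
      (simp add: comp_def permutes_inverses[OF \<pi>])
  also have "\<dots> = (\<Prod>i\<in>{1..n}. \<integral>\<^sup>+x. \<psi> (inv \<pi> i) x \<partial>item i)"
    unfolding value_space_item by (rule item.product_nn_integral_prod) (auto simp: measurable_cong_sets[OF sets_item refl])
  also have "\<dots> = (\<Prod>t\<in>{1..n}. \<integral>\<^sup>+x. \<psi> t x \<partial>item (\<pi> t))"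
    by (subst prod.permute[OF \<pi>]) (simp add: comp_def permutes_inverses[OF \<pi>])
  finally show ?thesis by (simp add: \<psi>_def)
qed

subsection \<open>Thresholds\<close>

lemma items_nonempty: "{1..n} \<noteq> {}"
  using n_pos by (simp add: Suc_le_eq One_nat_def)

text \<open>The distribution function of the item at \<theta> with its jump there scaled by
  \<open>q\<close>. A value tied with \<theta> fails to exceed it when its seed is at most
  \<open>q\<close>, so this is the probability of not exceeding \<theta> under tie-breaking.\<close>

definition below :: "real \<Rightarrow> real \<Rightarrow> nat \<Rightarrow> real" where
  "below \<theta> q i = measure (item i) {..<\<theta>} + q * measure (item i) {\<theta>}"

lemma measure_atMost_item: "measure (item i) {..\<theta>} = measure (item i) {..<\<theta>} + measure (item i) {\<theta>}"
proof -
  have "{..\<theta>} = {..<\<theta>} \<union> {\<theta>}" by auto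
  then show ?thesis by (subst item.M.finite_measure_Union[symmetric]) (auto simp: sets_item)
qed

lemma below_nonneg: "0 \<le> q \<Longrightarrow> 0 \<le> below \<theta> q i"
  by (simp add: below_def)

lemma below_le_1:
  assumes "q \<le> 1"
  shows "below \<theta> q i \<le> 1"
proof -
  have "below \<theta> q i \<le> measure (item i) {..\<theta>}"
    unfolding below_def measure_atMost_item using mult_right_mono[OF assms measure_nonneg] by simp
  then show ?thesis using item.M.prob_le_1 by (rule order_trans)
qed

lemma emeasure_seed_atMost:
  assumes "0 \<le> q" "q \<le> 1"
  shows "emeasure seed {..q} = ennreal q"
proof -
  have "{0..1} \<inter> {..q} = {0..q}" using assms by auto
  then show ?thesis using assms by (simp add: divide_ennreal_def)
qed

lemma nn_integral_not_exceeds: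
  assumes "0 \<le> q" "q \<le> 1"
  shows "(\<integral>\<^sup>+x. \<integral>\<^sup>+u. (if exceeds \<theta> q x u then 0 else 1) \<partial>seed \<partial>item i) = ennreal (below \<theta> q i)"
proof -
  have "(\<integral>\<^sup>+u. (if exceeds \<theta> q x u then 0 else 1) \<partial>seed) =
      indicator {..<\<theta>} x + ennreal q * indicator {\<theta>} x" for x
  proof (cases x \<theta> rule: linorder_cases)
    case equal
    have "(\<integral>\<^sup>+u. (if exceeds \<theta> q x u then 0 else 1) \<partial>seed) = (\<integral>\<^sup>+u. indicator {..q} u \<partial>seed)"
      by (intro nn_integral_cong) (auto simp: exceeds_def equal indicator_def)
    then show ?thesis using equal emeasure_seed_atMost[OF assms] by (simp del: emeasure_uniform_measure)
  qed (simp_all add: exceeds_def seed.M.emeasure_space_1)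
  then have "(\<integral>\<^sup>+x. \<integral>\<^sup>+u. (if exceeds \<theta> q x u then 0 else 1) \<partial>seed \<partial>item i)
      = emeasure (item i) {..<\<theta>} + ennreal q * emeasure (item i) {\<theta>}"
    by (simp add: nn_integral_add nn_integral_cmult sets_item)
  also have "\<dots> = ennreal (below \<theta> q i)"
    using assms by (simp add: item.M.emeasure_eq_measure below_def ennreal_mult)
  finally show ?thesis .
qed

lemma measurable_exceeds [measurable]:
  "Measurable.pred (borel \<Otimes>\<^sub>M borel) (\<lambda>(x, u). exceeds \<theta> q x u)"
  unfolding exceeds_def by measurable

lemma pred_exceeds_step:
  assumes "\<pi> permutes {1..n}" "t \<in> {1..n}"
  shows "Measurable.pred Q (\<lambda>z. exceeds \<theta> q (fst z (\<pi> t)) (snd z t))"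
  using permutes_in[OF assms] assms(2) unfolding exceeds_def by measurable

text \<open>The order determines which seed is paired with which value, but the probability is the
  same for all orders. The identity order gives the pairing used in
  \<open>prob_max_below\<close>.\<close>

lemma prob_none_exceeds:
  assumes \<pi>: "\<pi> permutes {1..n}" and q: "0 \<le> q" "q \<le> 1"
  shows "measure Q {z \<in> space Q. \<forall>t\<in>{1..n}. \<not> exceeds \<theta> q (fst z (\<pi> t)) (snd z t)}
    = (\<Prod>i\<in>{1..n}. below \<theta> q i)"
proof -
  let ?N = "{z \<in> space Q. \<forall>t\<in>{1..n}. \<not> exceeds \<theta> q (fst z (\<pi> t)) (snd z t)}"
  note [measurable] = pred_exceeds_step[OF \<pi>]
  have "emeasure Q ?N = (\<integral>\<^sup>+z. indicator ?N z \<partial>Q)"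
    by (rule nn_integral_indicator[symmetric]) measurable
  also have "\<dots> = (\<integral>\<^sup>+z. (\<Prod>t\<in>{1..n}. if exceeds \<theta> q (fst z (\<pi> t)) (snd z t) then 0 else 1) \<partial>Q)"
    by (intro nn_integral_cong) (auto simp: indicator_def prod_zero_iff)
  also have "\<dots> = (\<Prod>t\<in>{1..n}. ennreal (below \<theta> q (\<pi> t)))"
    by (subst nn_integral_prod_steps[OF \<pi>]) (simp_all add: nn_integral_not_exceeds[OF q])
  also have "\<dots> = (\<Prod>i\<in>{1..n}. ennreal (below \<theta> q i))"
    by (subst (2) prod.permute[OF \<pi>]) (simp add: comp_def)
  also have "\<dots> = ennreal (\<Prod>i\<in>{1..n}. below \<theta> q i)"
    by (intro prod_ennreal below_nonneg q)
  finally show ?thesis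
    by (simp add: Q.emeasure_eq_measure prod_nonneg below_nonneg q)
qed

lemma prob_max_below_eq:
  assumes "0 \<le> q" "q \<le> 1"
  shows "prob_max_below I \<theta> q = (\<Prod>i\<in>{1..n}. below \<theta> q i)"
  using prob_none_exceeds[OF permutes_id assms] by (simp add: prob_max_below_def)

text \<open>The value revealed at time \<open>t\<close> is independent of all that decides whether
  time \<open>t\<close> is reached, so the expectation factors; reaching it requires each of the
  earlier items to stay below.\<close>

lemma integral_excess_before:
  assumes \<pi>: "\<pi> permutes {1..n}" and t: "t \<in> {1..n}" and q: "0 \<le> q" "q \<le> 1"
  shows "(\<integral>z. max 0 (fst z (\<pi> t) - \<theta>) *
        of_bool (\<forall>s\<in>{1..<t}. \<not> exceeds \<theta> q (fst z (\<pi> s)) (snd z s)) \<partial>Q)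
    = (\<integral>x. max 0 (x - \<theta>) \<partial>item (\<pi> t)) * (\<Prod>s\<in>{1..<t}. below \<theta> q (\<pi> s))"
proof -
  let ?f = "\<lambda>z. max 0 (fst z (\<pi> t) - \<theta>) *
        of_bool (\<forall>s\<in>{1..<t}. \<not> exceeds \<theta> q (fst z (\<pi> s)) (snd z s))"
  define \<phi> :: "nat \<Rightarrow> real \<Rightarrow> real \<Rightarrow> ennreal" where
    "\<phi> s x u = (if s < t then (if exceeds \<theta> q x u then 0 else 1)
       else if s = t then ennreal (max 0 (x - \<theta>)) else 1)" for s x u
  have [measurable]: "case_prod (\<phi> s) \<in> borel_measurable (borel \<Otimes>\<^sub>M borel)" for s
    unfolding \<phi>_def by measurable
  have e: "(\<integral>\<^sup>+x. ennreal (max 0 (x - \<theta>)) \<partial>item (\<pi> t)) = ennreal (\<integral>x. max 0 (x - \<theta>) \<partial>item (\<pi> t))"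
    using integrable_item[OF permutes_in[OF \<pi> t]] by (intro nn_integral_eq_integral) auto
  note in_n = permutes_in[OF \<pi>]
  have meas: "?f \<in> borel_measurable Q"
  proof -
    have "Measurable.pred Q (\<lambda>z. \<forall>s\<in>{1..<t}. \<not> exceeds \<theta> q (fst z (\<pi> s)) (snd z s))"
      using t by (intro pred_intros_finite pred_intros_logic pred_exceeds_step[OF \<pi>]) auto
    moreover have "(\<lambda>z. fst z (\<pi> t)) \<in> borel_measurable Q"
      using in_n[OF t] by measurable
    ultimately show ?thesis by measurable
  qed
  have "(\<integral>\<^sup>+z. ennreal (?f z) \<partial>Q) = (\<integral>\<^sup>+z. (\<Prod>s\<in>{1..n}. \<phi> s (fst z (\<pi> s)) (snd z s)) \<partial>Q)"
  proof (rule nn_integral_cong)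
    fix z
    have "(\<Prod>s\<in>{1..n}. \<phi> s (fst z (\<pi> s)) (snd z s)) =
        (\<Prod>s\<in>{1..n}. if s < t then (if exceeds \<theta> q (fst z (\<pi> s)) (snd z s) then 0 else 1)
          else if s = t then ennreal (max 0 (fst z (\<pi> t) - \<theta>)) else 1)"
      by (intro prod.cong) (auto simp: \<phi>_def)
    also have "\<dots> = ennreal (?f z)"
      unfolding prod_upto_split[OF t] by (auto simp: prod_zero_iff)
    finally show "ennreal (?f z) = (\<Prod>s\<in>{1..n}. \<phi> s (fst z (\<pi> s)) (snd z s))" ..
  qed
  also have "\<dots> = (\<Prod>s\<in>{1..n}. \<integral>\<^sup>+x. \<integral>\<^sup>+u. \<phi> s x u \<partial>seed \<partial>item (\<pi> s))"
    by (rule nn_integral_prod_steps[OF \<pi>]) measurable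
  also have "\<dots> = (\<Prod>s\<in>{1..n}. if s < t then ennreal (below \<theta> q (\<pi> s))
      else if s = t then ennreal (\<integral>x. max 0 (x - \<theta>) \<partial>item (\<pi> t)) else 1)"
    by (intro prod.cong refl)
      (use e in \<open>auto simp: \<phi>_def nn_integral_not_exceeds[OF q] seed.M.emeasure_space_1
        prob_space.emeasure_space_1[OF prob_space_item, simplified]\<close>)
  also have "\<dots> = ennreal ((\<integral>x. max 0 (x - \<theta>) \<partial>item (\<pi> t)) * (\<Prod>s\<in>{1..<t}. below \<theta> q (\<pi> s)))"
    unfolding prod_upto_split[OF t]
    by (simp add: prod_ennreal below_nonneg q prod_nonneg ennreal_mult mult.commute)
  finally have "(\<integral>\<^sup>+z. ennreal (?f z) \<partial>Q) = \<dots>" .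
  then show ?thesis
    using meas by (subst integral_eq_nn_integral) (auto simp: prod_nonneg below_nonneg q)
qed

text \<open>\<theta> is the generalised \<open>p\<close>-quantile of the maximum, the infimum of
  \<open>{\<theta>. p \<le> G \<theta>}\<close>. By right continuity
  \<open>p \<le> G \<theta>\<close>, while the left limit of \<open>G\<close> at \<theta> is at most
  \<open>p\<close>. As \<open>q\<close> runs from 0 to 1, the product of
  \<open>below \<theta> q\<close> moves continuously from that left limit to
  \<open>G \<theta>\<close>, so it takes the value \<open>p\<close>.\<close>

lemma threshold_exists:
  assumes "0 < p" "p < 1"
  shows "\<exists>\<theta> q. 0 \<le> q \<and> q \<le> 1 \<and> prob_max_below I \<theta> q = p"
proof -
  have distr: "real_distribution (item i)" for i
    using prob_space_item sets_item
    by (auto simp: real_distribution_def real_distribution_axioms_def)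
  define G where "G \<theta> = (\<Prod>i\<in>{1..n}. cdf (item i) \<theta>)" for \<theta>
  define T where "T = {\<theta>. p \<le> G \<theta>}"
  have G_mono: "G x \<le> G y" if "x \<le> y" for x y
    unfolding G_def using that real_distribution.finite_borel_measure_M[OF distr]
    by (intro prod_mono) (auto intro: finite_borel_measure.cdf_nondecreasing finite_borel_measure.cdf_nonneg)
  have "(G \<longlongrightarrow> (\<Prod>i\<in>{1..n}. 1)) at_top"
    unfolding G_def by (intro tendsto_prod real_distribution.cdf_lim_at_top_prob distr)
  then have "eventually (\<lambda>\<theta>. p < G \<theta>) at_top"
    using assms by (intro order_tendstoD) auto
  then obtain \<theta>1 where "p < G \<theta>1" by (auto simp: eventually_at_top_linorder)
  then have T_ne: "T \<noteq> {}" by (auto simp: T_def intro: less_imp_le)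
  have "(G \<longlongrightarrow> (\<Prod>i\<in>{1..n}. 0)) at_bot"
    unfolding G_def using real_distribution.finite_borel_measure_M[OF distr]
    by (intro tendsto_prod finite_borel_measure.cdf_lim_at_bot)
  then have "eventually (\<lambda>\<theta>. G \<theta> < p) at_bot"
    using assms n_pos by (intro order_tendstoD(2)[where y = 0]) (auto simp: zero_power)
  then obtain \<theta>2 where \<theta>2: "G \<theta>2 < p" by (auto simp: eventually_at_bot_linorder)
  have T_bdd: "bdd_below T"
  proof (rule bdd_belowI)
    fix \<theta> assume "\<theta> \<in> T"
    then show "\<theta>2 \<le> \<theta>" using G_mono[of \<theta> \<theta>2] \<theta>2 by (auto simp: T_def not_less[symmetric])
  qed
  define \<theta> where "\<theta> = Inf T"
  have right: "p \<le> G \<theta>"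
  proof -
    have "(G \<longlongrightarrow> G \<theta>) (at_right \<theta>)"
      unfolding G_def using real_distribution.finite_borel_measure_M[OF distr]
      by (intro tendsto_prod finite_borel_measure.cdf_is_right_cont[unfolded continuous_within])
    moreover have "eventually (\<lambda>x. p \<le> G x) (at_right \<theta>)"
      unfolding eventually_at_right_field
    proof (intro exI[of _ "\<theta> + 1"] conjI allI impI)
      fix x assume "\<theta> < x"
      then obtain y where "y \<in> T" "y < x"
        using cInf_less_iff[OF T_ne T_bdd] by (auto simp: \<theta>_def)
      then show "p \<le> G x" using G_mono[of y x] by (auto simp: T_def)
    qed simp
    ultimately show ?thesis by (intro tendsto_lowerbound) auto
  qed
  have left: "(\<Prod>i\<in>{1..n}. measure (item i) {..<\<theta>}) \<le> p"
  proof -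
    have "(G \<longlongrightarrow> (\<Prod>i\<in>{1..n}. measure (item i) {..<\<theta>})) (at_left \<theta>)"
      unfolding G_def using real_distribution.finite_borel_measure_M[OF distr]
      by (intro tendsto_prod finite_borel_measure.cdf_at_left)
    moreover have "eventually (\<lambda>x. G x \<le> p) (at_left \<theta>)"
      unfolding eventually_at_left_field
    proof (intro exI[of _ "\<theta> - 1"] conjI allI impI)
      fix x assume "x < \<theta>"
      then have "x \<notin> T" using cInf_lower[OF _ T_bdd, of x] by (auto simp: \<theta>_def)
      then show "G x \<le> p" by (auto simp: T_def)
    qed simp
    ultimately show ?thesis by (intro tendsto_upperbound) auto
  qed
  have "\<exists>q\<ge>0. q \<le> 1 \<and> (\<Prod>i\<in>{1..n}. below \<theta> q i) = p"
  proof (rule IVT')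
    show "(\<Prod>i\<in>{1..n}. below \<theta> 0 i) \<le> p" using left by (simp add: below_def)
    show "p \<le> (\<Prod>i\<in>{1..n}. below \<theta> 1 i)"
      using right by (simp add: below_def G_def cdf_def measure_atMost_item)
    show "continuous_on {0..1} (\<lambda>q. \<Prod>i\<in>{1..n}. below \<theta> q i)"
      unfolding below_def by (intro continuous_intros)
  qed simp
  then obtain q where q: "0 \<le> q" "q \<le> 1" "(\<Prod>i\<in>{1..n}. below \<theta> q i) = p" by blast
  then show ?thesis using prob_max_below_eq[of q \<theta>] by blast
qed

section \<open>The maximum and the reward: bounds, measurability and integrability\<close>

lemma integrable_values_bounded:
  fixes f :: "(nat \<Rightarrow> real) \<times> (nat \<Rightarrow> real) \<Rightarrow> real"
  assumes "f \<in> borel_measurable Q"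
    and "\<And>z. z \<in> space Q \<Longrightarrow> \<bar>f z\<bar> \<le> c + (\<Sum>i\<in>{1..n}. \<bar>fst z i\<bar>)"
  shows "integrable Q f"
proof (rule Bochner_Integration.integrable_bound[OF _ assms(1)])
  show "integrable Q (\<lambda>z. c + (\<Sum>i\<in>{1..n}. \<bar>fst z i\<bar>))"
    by (intro Bochner_Integration.integrable_add Bochner_Integration.integrable_sum integrable_abs
        integrable_component[OF _ integrable_item]) auto
  show "AE z in Q. norm (f z) \<le> norm (c + (\<Sum>i\<in>{1..n}. \<bar>fst z i\<bar>))"
    using assms(2) by (intro AE_I2) (smt (verit) real_norm_def)
qed

lemma abs_le_sum_abs: "i \<in> {1..n} \<Longrightarrow> \<bar>X i :: real\<bar> \<le> (\<Sum>i\<in>{1..n}. \<bar>X i\<bar>)"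
  by (rule member_le_sum) auto

lemma max_value_ge: "i \<in> {1..n} \<Longrightarrow> X i \<le> max_value I X"
  unfolding max_value_def by (rule Max_ge) auto

lemma max_value_in: "\<exists>i\<in>{1..n}. max_value I X = X i"
proof -
  have "max_value I X \<in> X ` {1..n}"
    unfolding max_value_def using items_nonempty by (intro Max_in) auto
  then show ?thesis by auto
qed

lemma abs_max_value_le: "\<bar>max_value I X\<bar> \<le> (\<Sum>i\<in>{1..n}. \<bar>X i\<bar>)"
  using max_value_in[of X] abs_le_sum_abs[of _ X] by force

lemma measurable_max_value: "max_value I \<in> borel_measurable (value_space I)"
  unfolding max_value_def by (intro borel_measurable_Max) (auto intro: measurable_component)

lemma measurable_max_value_Q: "(\<lambda>z. max_value I (fst z)) \<in> borel_measurable Q"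
  by (rule measurable_compose[OF measurable_fst measurable_max_value])

lemma integrable_max_value: "integrable Q (\<lambda>z. max_value I (fst z))"
  by (rule integrable_values_bounded[where c = 0])
    (use measurable_max_value_Q abs_max_value_le in auto)

lemma integrable_max_value_value_space: "integrable (value_space I) (max_value I)"
  using integrable_max_value integrable_distr_eq[OF measurable_fst measurable_max_value, of "seed_space n"]
  by (simp only: S.distr_pair_fst)

lemma expected_max_Q: "expected_max I = (\<integral>z. max_value I (fst z) \<partial>Q)"
  unfolding expected_max_def
  using integral_distr[OF measurable_fst measurable_max_value, of "seed_space n"]
  by (simp only: S.distr_pair_fst)

text \<open>Both the sign and the size of the reward are read off from this.\<close>

lemma reward_in:
  assumes "\<pi> permutes {1..n}" and "1 \<le> k"
  shows "\<exists>i\<in>{1..n}. reward \<gamma> I (\<pi>, z) k = fst z i \<or> reward \<gamma> I (\<pi>, z) k = \<gamma> * fst z i"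
proof (cases "k \<le> n")
  case True
  have "Max (insert (revealed (\<pi>, z) k) ((\<lambda>s. \<gamma> * revealed (\<pi>, z) s) ` {1..<k}))
      \<in> insert (revealed (\<pi>, z) k) ((\<lambda>s. \<gamma> * revealed (\<pi>, z) s) ` {1..<k})"
    by (intro Max_in) auto
  then have "\<exists>s\<in>{1..n}. reward \<gamma> I (\<pi>, z) k = fst z (\<pi> s) \<or> reward \<gamma> I (\<pi>, z) k = \<gamma> * fst z (\<pi> s)"
    using True assms(2) unfolding reward_def by (cases z) fastforce
  then show ?thesis using permutes_in[OF assms(1)] by blast
next
  case False
  then show ?thesis using max_value_in[of "fst z"] by (auto simp: reward_def)
qed

lemma abs_reward_le:
  assumes "\<pi> permutes {1..n}" and "1 \<le> k" and "0 \<le> \<gamma>" and "\<gamma> \<le> 1"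
  shows "\<bar>reward \<gamma> I (\<pi>, z) k\<bar> \<le> (\<Sum>i\<in>{1..n}. \<bar>fst z i\<bar>)"
proof -
  obtain i where i: "i \<in> {1..n}"
    and "reward \<gamma> I (\<pi>, z) k = fst z i \<or> reward \<gamma> I (\<pi>, z) k = \<gamma> * fst z i"
    using reward_in[OF assms(1,2)] by blast
  then have "\<bar>reward \<gamma> I (\<pi>, z) k\<bar> \<le> \<bar>fst z i\<bar>"
    using assms(3,4) by (auto simp: abs_mult mult_left_le_one_le)
  also have "\<dots> \<le> (\<Sum>i\<in>{1..n}. \<bar>fst z i\<bar>)" using i by (rule abs_le_sum_abs)
  finally show ?thesis .
qed

text \<open>Makes the quotients in \<open>CR\<close> bounded below, so that their infimum is at most
  each of them.\<close>

lemma expected_reward_nonneg: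
  assumes "online_algorithm ALG" and \<gamma>: "0 \<le> \<gamma>"
  shows "0 \<le> expected_reward \<gamma> ALG I"
  unfolding expected_reward_def
proof (rule integral_nonneg_AE)
  have "AE X in value_space I. \<forall>i\<in>{1..n}. 0 \<le> X i"
    by (rule AE_values[OF item_nonneg])
  from AE_outcome_space[OF AE_Q[OF this]] AE_space
  show "AE \<omega> in outcome_space I. 0 \<le> reward \<gamma> I \<omega> (ALG I \<omega>)"
  proof eventually_elim
    case (elim \<omega>)
    obtain \<pi> z where \<omega>: "\<omega> = (\<pi>, z)" by (cases \<omega>)
    have \<pi>: "\<pi> permutes {1..n}" using elim(2) by (simp add: \<omega> space_outcome_space)
    have "1 \<le> ALG I \<omega>" using assms(1) inst elim(2) by (auto simp: online_algorithm_def)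
    then obtain i where "i \<in> {1..n}" "reward \<gamma> I (\<pi>, z) (ALG I \<omega>) = fst z i \<or>
        reward \<gamma> I (\<pi>, z) (ALG I \<omega>) = \<gamma> * fst z i"
      using reward_in[OF \<pi>] by blast
    then show ?case using elim(1) \<gamma> by (auto simp: \<omega>)
  qed
qed

lemma measurable_reward:
  assumes \<pi>: "\<pi> permutes {1..n}" and k: "1 \<le> k"
  shows "(\<lambda>z. reward \<gamma> I (\<pi>, z) k) \<in> borel_measurable Q"
proof (cases "k \<le> n")
  case True
  have X: "(\<lambda>z. fst z (\<pi> s)) \<in> borel_measurable Q" if "s \<in> {1..n}" for s
    using permutes_in[OF \<pi> that] by measurable
  have rev: "revealed (\<pi>, z) s = fst z (\<pi> s)" for z s by (cases z) simp
  show ?thesis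
  proof (cases "k = 1")
    case True
    then have "(\<lambda>z. reward \<gamma> I (\<pi>, z) k) = (\<lambda>z. fst z (\<pi> 1))"
      using \<open>k \<le> n\<close> by (simp add: reward_def rev fun_eq_iff)
    then show ?thesis using X[of 1] True \<open>k \<le> n\<close> by (simp only:) auto
  next
    case False
    then have "{1..<k} \<noteq> {}" using k by auto
    then have "reward \<gamma> I (\<pi>, z) k = max (fst z (\<pi> k)) (Max ((\<lambda>s. \<gamma> * fst z (\<pi> s)) ` {1..<k}))" for z
      using \<open>k \<le> n\<close> by (simp add: reward_def rev)
    moreover have "(\<lambda>z. Max ((\<lambda>s. \<gamma> * fst z (\<pi> s)) ` {1..<k})) \<in> borel_measurable Q"
      using \<open>k \<le> n\<close> by (intro borel_measurable_Max borel_measurable_times X) auto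
    moreover have "(\<lambda>z. fst z (\<pi> k)) \<in> borel_measurable Q"
      using True k by (intro X) auto
    ultimately show ?thesis by (simp only: borel_measurable_max)
  qed
next
  case False
  then have "(\<lambda>z. reward \<gamma> I (\<pi>, z) k) = (\<lambda>z. \<gamma> * max_value I (fst z))"
    by (simp add: reward_def fun_eq_iff)
  then show ?thesis
    using measurable_max_value_Q by (simp only: borel_measurable_times borel_measurable_const)
qed

lemma observation_pair: "observation (\<pi>, z) s = (\<pi> s, fst z (\<pi> s), snd z s)"
  by (cases z) simp

section \<open>Lower bound for the expected reward of a threshold rule\<close>

lemma integrable_threshold_reward:
  assumes \<pi>: "\<pi> permutes {1..n}" and \<gamma>: "0 \<le> \<gamma>" "\<gamma> \<le> 1"
  shows "integrable Q (\<lambda>z. reward \<gamma> I (\<pi>, z) (threshold_time \<theta> q n (\<pi>, z)))"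
proof (rule integrable_values_bounded[where c = 0])
  have le: "Measurable.pred Q (\<lambda>z. threshold_time \<theta> q n (\<pi>, z) \<le> t)" for t
  proof -
    have "Measurable.pred Q (\<lambda>z. n < t \<or>
        (\<exists>s\<in>{1..min t n}. exceeds \<theta> q (fst z (\<pi> s)) (snd z s)))"
      by (intro pred_intros_logic pred_intros_finite pred_exceeds_step[OF \<pi>]) auto
    moreover have "observation (\<pi>, z) s = (\<pi> s, fst z (\<pi> s), snd z s)" for z s
      by (cases z) simp
    ultimately show ?thesis unfolding threshold_time_le_iff by (simp only: fst_conv snd_conv)
  qed
  have range: "threshold_time \<theta> q n (\<pi>, z) \<in> {1..n + 1}" for z
  proof -
    have "\<not> threshold_time \<theta> q n (\<pi>, z) \<le> 0" "threshold_time \<theta> q n (\<pi>, z) \<le> n + 1"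
      unfolding threshold_time_le_iff by auto
    then show ?thesis by auto
  qed
  have "(\<lambda>z. threshold_time \<theta> q n (\<pi>, z)) \<in> measurable Q (count_space {1..n + 1})"
  proof (subst measurable_count_space_eq2, intro finite_atLeastAtMost, intro conjI ballI)
    fix k assume "k \<in> {1..n + 1}"
    have "threshold_time \<theta> q n (\<pi>, z) = k \<longleftrightarrow> threshold_time \<theta> q n (\<pi>, z) \<le> k \<and>
        (\<forall>j\<in>{..<k}. \<not> threshold_time \<theta> q n (\<pi>, z) \<le> j)" for z
      by (auto simp: not_le)
    then have "(\<lambda>z. threshold_time \<theta> q n (\<pi>, z)) -` {k} \<inter> space Q =
        {z\<in>space Q. threshold_time \<theta> q n (\<pi>, z) \<le> k \<and>
        (\<forall>j\<in>{..<k}. \<not> threshold_time \<theta> q n (\<pi>, z) \<le> j)}" by auto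
    also have "\<dots> \<in> sets Q"
      by (intro predE pred_intros_logic pred_intros_finite le finite_lessThan)
    finally show "(\<lambda>z. threshold_time \<theta> q n (\<pi>, z)) -` {k} \<inter> space Q \<in> sets Q" .
  qed (use range in auto)
  then show "(\<lambda>z. reward \<gamma> I (\<pi>, z) (threshold_time \<theta> q n (\<pi>, z))) \<in> borel_measurable Q"
    by (rule measurable_compose_countable'[rotated]) (auto intro: measurable_reward[OF \<pi>])
  show "\<bar>reward \<gamma> I (\<pi>, z) (threshold_time \<theta> q n (\<pi>, z))\<bar> \<le> 0 + (\<Sum>i\<in>{1..n}. \<bar>fst z i\<bar>)" for z
    using abs_reward_le[OF \<pi> _ \<gamma>] range[of z] by auto
qed

text \<open>If nothing exceeds \<theta>, the rule runs to time \<open>n + 1\<close>, earns \<gamma>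
  times the maximum, and all excesses vanish. If it stops at time \<open>k\<close>, only the summand
  \<open>t = k\<close> survives: earlier excesses are zero and later times are not reached. The
  left-hand side is then \<theta> plus the excess at \<open>k\<close>, which is the value
  taken.\<close>

lemma threshold_reward_ge:
  fixes z :: "(nat \<Rightarrow> real) \<times> (nat \<Rightarrow> real)" and \<gamma> \<theta> q :: real
  assumes \<pi>: "\<pi> permutes {1..n}"
  defines "E t \<equiv> exceeds \<theta> q (fst z (\<pi> t)) (snd z t)"
  shows "\<theta> * of_bool (\<not> (\<forall>t\<in>{1..n}. \<not> E t)) + \<gamma> * (max_value I (fst z) * of_bool (\<forall>t\<in>{1..n}. \<not> E t))
      + (\<Sum>t\<in>{1..n}. max 0 (fst z (\<pi> t) - \<theta>) * of_bool (\<forall>s\<in>{1..<t}. \<not> E s))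
    \<le> reward \<gamma> I (\<pi>, z) (threshold_time \<theta> q n (\<pi>, z))" (is "?L \<le> reward _ _ _ ?\<tau>")
proof -
  have not_E: "fst z (\<pi> t) \<le> \<theta>" if "\<not> E t" for t
    using that by (auto simp: E_def exceeds_def)
  have obs: "observation (\<pi>, z) s = (\<pi> s, fst z (\<pi> s), snd z s)" for s by (cases z) simp
  have \<tau>_le: "?\<tau> \<le> t \<longleftrightarrow> n < t \<or> (\<exists>s\<in>{1..min t n}. E s)" for t
    unfolding threshold_time_le_iff obs E_def by simp
  show ?thesis
  proof (cases "\<forall>t\<in>{1..n}. \<not> E t")
    case True
    then have "\<not> ?\<tau> \<le> n" unfolding \<tau>_le by auto
    moreover have "(\<Sum>t\<in>{1..n}. max 0 (fst z (\<pi> t) - \<theta>) * of_bool (\<forall>s\<in>{1..<t}. \<not> E s)) = 0"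
      using True not_E by (intro sum.neutral) (simp add: max_absorb1)
    ultimately show ?thesis using True by (simp add: reward_def)
  next
    case False
    define k where "k = ?\<tau>"
    have k: "1 \<le> k" "k \<le> n"
      using False \<tau>_le[of 0] \<tau>_le[of n] by (auto simp: k_def One_nat_def)
    have "\<exists>s\<in>{1..k}. E s" using \<tau>_le[of k] k by (auto simp: k_def)
    moreover have before: "\<not> E s" if "s \<in> {1..<k}" for s
      using \<tau>_le[of s] that k by (auto simp: k_def)
    ultimately have Ek: "E k" by (metis atLeastAtMost_iff atLeastLessThan_iff le_neq_implies_less)
    have "(\<Sum>t\<in>{1..n}. max 0 (fst z (\<pi> t) - \<theta>) * of_bool (\<forall>s\<in>{1..<t}. \<not> E s))
        = (\<Sum>t\<in>{1..n}. if t = k then max 0 (fst z (\<pi> k) - \<theta>) else 0)"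
    proof (rule sum.cong[OF refl])
      fix t assume t: "t \<in> {1..n}"
      consider "t < k" | "t = k" | "k < t" by linarith
      then show "max 0 (fst z (\<pi> t) - \<theta>) * of_bool (\<forall>s\<in>{1..<t}. \<not> E s)
          = (if t = k then max 0 (fst z (\<pi> k) - \<theta>) else 0)"
      proof cases
        case 1
        then have "fst z (\<pi> t) \<le> \<theta>" using before[of t] t not_E by auto
        then show ?thesis using 1 by simp
      next
        case 2
        then show ?thesis using before by auto
      next
        case 3
        then have "\<not> (\<forall>s\<in>{1..<t}. \<not> E s)" using Ek k by auto
        then show ?thesis using 3 by simp
      qed
    qed
    also have "\<dots> = max 0 (fst z (\<pi> k) - \<theta>)" using k by simp
    also have "\<dots> = fst z (\<pi> k) - \<theta>" using Ek by (auto simp: E_def exceeds_def)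
    finally have "?L = fst z (\<pi> k)" using False by simp
    moreover have "revealed (\<pi>, z) k = fst z (\<pi> k)" by (cases z) simp
    ultimately have "?L \<le> reward \<gamma> I (\<pi>, z) k"
      using k by (simp add: reward_def)
    then show ?thesis by (simp add: k_def)
  qed
qed

text \<open>With \<open>A\<close> the expectation of the maximum on \<open>N\<close>, the maximum is
  in expectation at most \<open>A + \<theta> * (1 - p)\<close> plus all the excesses, while the
  reward is at least \<open>\<gamma> * A + \<theta> * (1 - p)\<close> plus the excesses of the items
  that are reached. The factor compares the two expressions without the excesses, whose comparison
  is left to the average over the orders.\<close>

lemma threshold_reward_order_ge:
  assumes \<pi>: "\<pi> permutes {1..n}" and \<gamma>: "0 \<le> \<gamma>" "\<gamma> \<le> 1" and q: "0 \<le> q" "q \<le> 1"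
    and p: "prob_max_below I \<theta> q = p"
  defines "e i \<equiv> \<integral>x. max 0 (x - \<theta>) \<partial>item i"
  shows "(1 - (1 - \<gamma>) * p) * (expected_max I - (\<Sum>i\<in>{1..n}. e i))
      + (\<Sum>t\<in>{1..n}. e (\<pi> t) * (\<Prod>s\<in>{1..<t}. below \<theta> q (\<pi> s)))
    \<le> (\<integral>z. reward \<gamma> I (\<pi>, z) (threshold_time \<theta> q n (\<pi>, z)) \<partial>Q)"
proof -
  define E where "E z t \<longleftrightarrow> exceeds \<theta> q (fst z (\<pi> t)) (snd z t)"
    for z :: "(nat \<Rightarrow> real) \<times> (nat \<Rightarrow> real)" and t
  define N where "N = {z\<in>space Q. \<forall>t\<in>{1..n}. \<not> E z t}"
  define A where "A = (\<integral>z. max_value I (fst z) * indicator N z \<partial>Q)"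
  have pE [measurable]: "Measurable.pred Q (\<lambda>z. E z t)" if "t \<in> {1..n}" for t
    unfolding E_def by (rule pred_exceeds_step[OF \<pi> that])
  have N [measurable]: "N \<in> sets Q" unfolding N_def by measurable
  have ind: "indicator N z = (of_bool (\<forall>t\<in>{1..n}. \<not> E z t) :: real)"
    "1 - indicator N z = (of_bool (\<not> (\<forall>t\<in>{1..n}. \<not> E z t)) :: real)" if "z \<in> space Q" for z
    using that by (auto simp: N_def indicator_def)
  have probN: "measure Q N = p"
    using prob_none_exceeds[OF \<pi> q] prob_max_below_eq[OF q] p by (simp add: N_def E_def)
  have p01: "0 \<le> p" "p \<le> 1" unfolding probN[symmetric] by auto
  have iN: "integrable Q (\<lambda>z. indicator N z :: real)"
    by (rule integrable_real_indicator[OF N]) (simp add: less_top[symmetric])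
  have iA: "integrable Q (\<lambda>z. max_value I (fst z) * indicator N z)"
    using integrable_real_mult_indicator[OF N integrable_max_value] by (simp add: mult.commute)
  have i1: "integrable Q (\<lambda>z. \<theta> * (1 - indicator N z))" using iN by simp
  have int1: "(\<integral>z. \<theta> * (1 - indicator N z) \<partial>Q) = \<theta> * (1 - p)"
    using probN iN by (simp add: Bochner_Integration.integral_diff[OF _ iN] Q.prob_space)
  have ie: "integrable (item i) (\<lambda>x. max 0 (x - \<theta>))" if "i \<in> {1..n}" for i
    using integrable_item[OF that] by auto
  have ieQ: "integrable Q (\<lambda>z. max 0 (fst z i - \<theta>))" if "i \<in> {1..n}" for i
    by (rule integrable_component[OF that ie[OF that]])
  have i2: "integrable Q (\<lambda>z. \<Sum>i\<in>{1..n}. max 0 (fst z i - \<theta>))"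
    by (intro Bochner_Integration.integrable_sum ieQ)
  have int2: "(\<integral>z. (\<Sum>i\<in>{1..n}. max 0 (fst z i - \<theta>)) \<partial>Q) = (\<Sum>i\<in>{1..n}. e i)"
    unfolding e_def
    by (subst Bochner_Integration.integral_sum[OF ieQ]) (auto intro!: sum.cong integral_component ie)
  \<comment> \<open>Pointwise, the maximum is itself on \<open>N\<close>; off \<open>N\<close> it is
    at most \<theta> plus its own excess, which is one term of the sum of excesses.\<close>
  have "expected_max I \<le> (\<integral>z. max_value I (fst z) * indicator N z + \<theta> * (1 - indicator N z)
      + (\<Sum>i\<in>{1..n}. max 0 (fst z i - \<theta>)) \<partial>Q)"
    unfolding expected_max_Q
  proof (rule integral_mono)
    fix z assume z: "z \<in> space Q"
    obtain i where i: "i \<in> {1..n}" "max_value I (fst z) = fst z i"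
      using max_value_in by blast
    have "fst z i - \<theta> \<le> max 0 (fst z i - \<theta>)" by simp
    also have "\<dots> \<le> (\<Sum>i\<in>{1..n}. max 0 (fst z i - \<theta>))"
      using i(1) by (intro member_le_sum) auto
    finally have "max_value I (fst z) \<le> \<theta> + (\<Sum>i\<in>{1..n}. max 0 (fst z i - \<theta>))" using i(2) by simp
    moreover have "0 \<le> (\<Sum>i\<in>{1..n}. max 0 (fst z i - \<theta>))" by (intro sum_nonneg) auto
    ultimately show "max_value I (fst z) \<le> max_value I (fst z) * indicator N z
        + \<theta> * (1 - indicator N z) + (\<Sum>i\<in>{1..n}. max 0 (fst z i - \<theta>))"
      by (auto simp: indicator_def)
  qed (intro integrable_max_value Bochner_Integration.integrable_add iA i1 i2)+
  also have "\<dots> = A + \<theta> * (1 - p) + (\<Sum>i\<in>{1..n}. e i)"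
    by (simp only: Bochner_Integration.integral_add Bochner_Integration.integrable_add
        iA i1 i2 int1 int2 A_def)
  finally have max_le: "expected_max I \<le> A + \<theta> * (1 - p) + (\<Sum>i\<in>{1..n}. e i)" .
  \<comment> \<open>On \<open>N\<close> every value is at most \<theta>, whichever time it arrives
    at.\<close>
  have "A \<le> (\<integral>z. \<theta> * indicator N z \<partial>Q)"
    unfolding A_def
  proof (rule integral_mono[OF iA])
    fix z assume z: "z \<in> space Q"
    obtain i where i: "i \<in> {1..n}" "max_value I (fst z) = fst z i"
      using max_value_in by blast
    have "inv \<pi> i \<in> {1..n}" using permutes_in[OF permutes_inv[OF \<pi>] i(1)] .
    then have "z \<in> N \<Longrightarrow> \<not> exceeds \<theta> q (fst z (\<pi> (inv \<pi> i))) (snd z (inv \<pi> i))"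
      by (auto simp: N_def E_def)
    then have "z \<in> N \<Longrightarrow> fst z i \<le> \<theta>"
      by (auto simp: permutes_inverses[OF \<pi>] exceeds_def)
    then show "max_value I (fst z) * indicator N z \<le> \<theta> * indicator N z"
      using i(2) by (auto simp: indicator_def)
  qed (intro integrable_mult_right iN)
  also have "\<dots> = \<theta> * p" using probN by simp
  finally have A_le: "A \<le> \<theta> * p" .
  let ?T = "\<lambda>z t. max 0 (fst z (\<pi> t) - \<theta>) * of_bool (\<forall>s\<in>{1..<t}. \<not> E z s)"
  have iT: "integrable Q (\<lambda>z. ?T z t)" if t: "t \<in> {1..n}" for t
  proof (rule Bochner_Integration.integrable_bound[OF ieQ[OF permutes_in[OF \<pi> t]]])
    have "Measurable.pred Q (\<lambda>z. \<forall>s\<in>{1..<t}. \<not> E z s)"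
      using t by (intro pred_intros_finite pred_intros_logic pE) auto
    moreover have "(\<lambda>z. fst z (\<pi> t)) \<in> borel_measurable Q"
      using permutes_in[OF \<pi> t] by measurable
    ultimately show "(\<lambda>z. ?T z t) \<in> borel_measurable Q" by measurable
  qed (auto simp: of_bool_def)
  have iT': "integrable Q (\<lambda>z. \<Sum>t\<in>{1..n}. ?T z t)"
    by (intro Bochner_Integration.integrable_sum iT)
  have intT: "(\<integral>z. (\<Sum>t\<in>{1..n}. ?T z t) \<partial>Q)
      = (\<Sum>t\<in>{1..n}. e (\<pi> t) * (\<Prod>s\<in>{1..<t}. below \<theta> q (\<pi> s)))"
    unfolding e_def E_def
    by (subst Bochner_Integration.integral_sum[OF iT[unfolded E_def]])
      (auto intro!: sum.cong integral_excess_before[OF \<pi> _ q])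
  have iG: "integrable Q (\<lambda>z. \<gamma> * (max_value I (fst z) * indicator N z))"
    by (intro integrable_mult_right iA)
  have intG: "(\<integral>z. \<gamma> * (max_value I (fst z) * indicator N z) \<partial>Q) = \<gamma> * A"
    by (simp add: A_def)
  have "\<theta> * (1 - p) + \<gamma> * A + (\<Sum>t\<in>{1..n}. e (\<pi> t) * (\<Prod>s\<in>{1..<t}. below \<theta> q (\<pi> s)))
      = (\<integral>z. \<theta> * (1 - indicator N z) + \<gamma> * (max_value I (fst z) * indicator N z) + (\<Sum>t\<in>{1..n}. ?T z t) \<partial>Q)"
    by (simp only: Bochner_Integration.integral_add Bochner_Integration.integrable_add
        i1 iG iT' int1 intT intG)
  also have "\<dots> \<le> (\<integral>z. reward \<gamma> I (\<pi>, z) (threshold_time \<theta> q n (\<pi>, z)) \<partial>Q)"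
  proof (rule integral_mono)
    show "integrable Q (\<lambda>z. \<theta> * (1 - indicator N z) + \<gamma> * (max_value I (fst z) * indicator N z)
        + (\<Sum>t\<in>{1..n}. ?T z t))"
      by (intro Bochner_Integration.integrable_add i1 iG iT')
    show "integrable Q (\<lambda>z. reward \<gamma> I (\<pi>, z) (threshold_time \<theta> q n (\<pi>, z)))"
      by (rule integrable_threshold_reward[OF \<pi> \<gamma>])
    show "\<theta> * (1 - indicator N z) + \<gamma> * (max_value I (fst z) * indicator N z) + (\<Sum>t\<in>{1..n}. ?T z t)
        \<le> reward \<gamma> I (\<pi>, z) (threshold_time \<theta> q n (\<pi>, z))" if z: "z \<in> space Q" for z
      unfolding ind(2)[OF z] unfolding ind(1)[OF z] E_def by (rule threshold_reward_ge[OF \<pi>])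
  qed
  finally have rew: "\<theta> * (1 - p) + \<gamma> * A + (\<Sum>t\<in>{1..n}. e (\<pi> t) * (\<Prod>s\<in>{1..<t}. below \<theta> q (\<pi> s)))
      \<le> (\<integral>z. reward \<gamma> I (\<pi>, z) (threshold_time \<theta> q n (\<pi>, z)) \<partial>Q)" .
  have "0 \<le> 1 - (1 - \<gamma>) * p" using mult_mono[of "1 - \<gamma>" 1 p 1] \<gamma> p01 by simp
  then have "(1 - (1 - \<gamma>) * p) * (expected_max I - (\<Sum>i\<in>{1..n}. e i))
      \<le> (1 - (1 - \<gamma>) * p) * (A + \<theta> * (1 - p))"
    using max_le by (intro mult_left_mono) auto
  \<comment> \<open>The factor is tuned to give equality when \<open>A = \<theta> * p\<close>, its
    largest possible value; the remainder shows that a smaller \<open>A\<close> leaves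
    slack.\<close>
  also have "\<dots> = \<theta> * (1 - p) + \<gamma> * A - (1 - \<gamma>) * (1 - p) * (\<theta> * p - A)"
    by (simp add: algebra_simps)
  also have "\<dots> \<le> \<theta> * (1 - p) + \<gamma> * A"
    using \<gamma> p01 A_le by simp
  finally show ?thesis using rew by linarith
qed

text \<open>Grouping the orders by the item that arrives at time \<open>t\<close> isolates the
  weight of each \<open>e i\<close>. \<open>sum_prod_before_ge\<close> bounds it for each
  \<open>t\<close>, and \<open>mean_powr_ge\<close> bounds the resulting average over
  \<open>t\<close>.\<close>

lemma sum_orders_reach_ge:
  assumes q: "0 \<le> q" "q \<le> 1" and p: "prob_max_below I \<theta> q = p" "0 < p" "p < 1"
    and e: "\<And>i. i \<in> {1..n} \<Longrightarrow> 0 \<le> e i"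
  shows "fact n * ((1 - p) / (- ln p)) * (\<Sum>i\<in>{1..n}. e i)
    \<le> (\<Sum>\<pi>\<in>orders. \<Sum>t\<in>{1..n}. e (\<pi> t) * (\<Prod>s\<in>{1..<t}. below \<theta> q (\<pi> s)))"
proof -
  let ?b = "below \<theta> q"
  have prod: "(\<Prod>i\<in>{1..n}. ?b i) = p" using prob_max_below_eq[OF q] p by simp
  \<comment> \<open>The AM-GM bound takes logarithms of these probabilities; none is zero because
    their product is \<open>p\<close>.\<close>
  have pos: "0 < ?b i" if i: "i \<in> {1..n}" for i
  proof -
    have "?b i \<noteq> 0" using prod p(2) i prod_zero[of "{1..n}" ?b] by (metis finite_atLeastAtMost less_irrefl)
    then show ?thesis using below_nonneg[OF q(1), of \<theta> i] by simp
  qed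
  have "fact n * ((1 - p) / (- ln p)) \<le> fact n * ((\<Sum>t\<in>{1..n}. p powr ((real t - 1) / (real n - 1))) / n)"
    by (intro mult_left_mono mean_powr_ge p n_pos) simp
  then have "fact n * ((1 - p) / (- ln p)) * (\<Sum>i\<in>{1..n}. e i)
      \<le> fact n * ((\<Sum>t\<in>{1..n}. p powr ((real t - 1) / (real n - 1))) / n) * (\<Sum>i\<in>{1..n}. e i)"
    by (intro mult_right_mono sum_nonneg e)
  also have "\<dots> = (\<Sum>t\<in>{1..n}. \<Sum>i\<in>{1..n}. e i * (fact n / n * p powr ((real t - 1) / (real n - 1))))"
    by (simp add: sum_distrib_left sum_distrib_right sum_divide_distrib mult_ac)
  also have "\<dots> \<le> (\<Sum>t\<in>{1..n}. \<Sum>i\<in>{1..n}. e i *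
      (\<Sum>\<pi> | \<pi> permutes {1..n} \<and> \<pi> t = i. \<Prod>s\<in>{1..<t}. ?b (\<pi> s)))"
    using sum_prod_before_ge[of _ n _ ?b] pos below_le_1[OF q(2)] prod
    by (intro sum_mono mult_left_mono e) auto
  also have "\<dots> = (\<Sum>t\<in>{1..n}. \<Sum>\<pi>\<in>orders. e (\<pi> t) * (\<Prod>s\<in>{1..<t}. ?b (\<pi> s)))"
  proof (rule sum.cong[OF refl])
    fix t assume t: "t \<in> {1..n}"
    have "(\<Sum>i\<in>{1..n}. e i * (\<Sum>\<pi> | \<pi> permutes {1..n} \<and> \<pi> t = i. \<Prod>s\<in>{1..<t}. ?b (\<pi> s)))
        = (\<Sum>i\<in>{1..n}. \<Sum>\<pi> | \<pi> \<in> orders \<and> \<pi> t = i. e (\<pi> t) * (\<Prod>s\<in>{1..<t}. ?b (\<pi> s)))"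
      by (simp add: sum_distrib_left)
    also have "\<dots> = (\<Sum>\<pi>\<in>orders. e (\<pi> t) * (\<Prod>s\<in>{1..<t}. ?b (\<pi> s)))"
      using permutes_in t finite_orders by (intro sum.group) auto
    finally show "(\<Sum>i\<in>{1..n}. e i * (\<Sum>\<pi> | \<pi> permutes {1..n} \<and> \<pi> t = i. \<Prod>s\<in>{1..<t}. ?b (\<pi> s)))
        = (\<Sum>\<pi>\<in>orders. e (\<pi> t) * (\<Prod>s\<in>{1..<t}. ?b (\<pi> s)))" .
  qed
  also have "\<dots> = (\<Sum>\<pi>\<in>orders. \<Sum>t\<in>{1..n}. e (\<pi> t) * (\<Prod>s\<in>{1..<t}. ?b (\<pi> s)))"
    by (rule sum.swap)
  finally show ?thesis .
qed

text \<open>In the average over the orders, the excesses are collected with weight at least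
  \<open>(1 - p) / (- ln p)\<close>. By the equation for \<open>p\<close> this weight is
  \<open>?c\<close>, exactly the multiple of the excesses that the bound for a single order
  subtracts.\<close>

lemma threshold_expected_reward_ge:
  assumes \<gamma>: "0 \<le> \<gamma>" "\<gamma> \<le> 1" and p: "0 < p" "p < 1" "1 - (1 - \<gamma>) * p = (1 - p) / (- ln p)"
    and q: "0 \<le> q I" "q I \<le> 1" and below: "prob_max_below I (\<theta> I) (q I) = p"
  shows "(1 - (1 - \<gamma>) * p) * expected_max I \<le> expected_reward \<gamma> (single_threshold \<theta> q) I"
proof -
  let ?c = "1 - (1 - \<gamma>) * p"
  define e where "e i = (\<integral>x. max 0 (x - \<theta> I) \<partial>item i)" for i
  have e: "0 \<le> e i" for i unfolding e_def by (rule integral_nonneg_AE) auto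
  let ?R = "\<lambda>\<pi>. \<Sum>t\<in>{1..n}. e (\<pi> t) * (\<Prod>s\<in>{1..<t}. below (\<theta> I) (q I) (\<pi> s))"
  have card: "real (card orders) = fact n" by (simp add: card_permutations)
  have "fact n * (?c * expected_max I)
      = (\<Sum>\<pi>\<in>orders. ?c * (expected_max I - (\<Sum>i\<in>{1..n}. e i))) + fact n * ?c * (\<Sum>i\<in>{1..n}. e i)"
    using card by (simp add: algebra_simps)
  also have "\<dots> \<le> (\<Sum>\<pi>\<in>orders. ?c * (expected_max I - (\<Sum>i\<in>{1..n}. e i))) + (\<Sum>\<pi>\<in>orders. ?R \<pi>)"
    using sum_orders_reach_ge[OF q below p(1,2), of e] e unfolding p(3) by (intro add_left_mono) auto
  also have "\<dots> \<le> (\<Sum>\<pi>\<in>orders. \<integral>z. reward \<gamma> I (\<pi>, z) (threshold_time (\<theta> I) (q I) n (\<pi>, z)) \<partial>Q)"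
    unfolding sum.distrib[symmetric] e_def
    using threshold_reward_order_ge[OF _ \<gamma> q below] by (intro sum_mono) auto
  also have "\<dots> = fact n * expected_reward \<gamma> (single_threshold \<theta> q) I"
    unfolding expected_reward_def single_threshold_def
    by (subst integral_outcome_space) (auto intro: integrable_threshold_reward[OF _ \<gamma>])
  finally show ?thesis by simp
qed

subsection \<open>Independence of the past\<close>

text \<open>A past event depends on the outcome only through its first \<open>min t n\<close>
  observations.\<close>

lemma past_event_vimage:
  assumes "A \<in> sets (observed_info I t)"
  obtains B where "B \<in> sets (\<Pi>\<^sub>M s\<in>{1..min t n}. count_space UNIV \<Otimes>\<^sub>M (borel \<Otimes>\<^sub>M borel))"
    and "A = (\<lambda>\<omega>. \<lambda>s\<in>{1..min t n}. observation \<omega> s) -` B \<inter> space (outcome_space I)"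
proof -
  have "(\<lambda>\<omega>. \<lambda>s\<in>{1..min t n}. observation \<omega> s) \<in> space (outcome_space I) \<rightarrow>
      space (\<Pi>\<^sub>M s\<in>{1..min t n}. count_space UNIV \<Otimes>\<^sub>M (borel \<Otimes>\<^sub>M borel))"
    by (auto simp: space_PiM space_pair_measure)
  from sets_vimage_algebra2[OF this] assms that show ?thesis
    by (auto simp: observed_info_def)
qed

lemma past_event_slice:
  assumes "\<pi> permutes {1..n}" and "A \<in> sets (observed_info I t)"
  shows "{z \<in> space Q. (\<pi>, z) \<in> A} \<in> sets Q"
proof -
  obtain B where B [measurable]: "B \<in> sets (\<Pi>\<^sub>M s\<in>{1..min t n}. count_space UNIV \<Otimes>\<^sub>M (borel \<Otimes>\<^sub>M borel))"
    and A: "A = (\<lambda>\<omega>. \<lambda>s\<in>{1..min t n}. observation \<omega> s) -` B \<inter> space (outcome_space I)"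
    using past_event_vimage[OF assms(2)] .
  have "(\<lambda>z. \<lambda>s\<in>{1..min t n}. (\<pi> s, fst z (\<pi> s), snd z s))
      \<in> measurable Q (\<Pi>\<^sub>M s\<in>{1..min t n}. count_space UNIV \<Otimes>\<^sub>M (borel \<Otimes>\<^sub>M borel))"
  proof (rule measurable_restrict)
    fix s assume "s \<in> {1..min t n}"
    then have s: "s \<in> {1..n}" by auto
    have "(\<lambda>z. fst z (\<pi> s)) \<in> borel_measurable Q" "(\<lambda>z. snd z s) \<in> borel_measurable Q"
      using permutes_in[OF assms(1) s] s by measurable
    then show "(\<lambda>z. (\<pi> s, fst z (\<pi> s), snd z s)) \<in> measurable Q (count_space UNIV \<Otimes>\<^sub>M (borel \<Otimes>\<^sub>M borel))"
      by (intro measurable_Pair measurable_const) auto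
  qed
  from measurable_sets[OF this B] have "(\<lambda>z. \<lambda>s\<in>{1..min t n}. (\<pi> s, fst z (\<pi> s), snd z s)) -` B \<inter> space Q \<in> sets Q" .
  also have "(\<lambda>z. \<lambda>s\<in>{1..min t n}. (\<pi> s, fst z (\<pi> s), snd z s)) -` B \<inter> space Q = {z \<in> space Q. (\<pi>, z) \<in> A}"
    using assms(1) by (simp only: A vimage_def space_outcome_space observation_pair[symmetric]) auto
  finally show ?thesis .
qed

text \<open>By injectivity of \<open>\<pi>\<close>, the item arriving at time \<open>t\<close> is
  not among those observed up to \<open>t - 1\<close>, so changing its value leaves the observations
  as they were.\<close>

lemma past_event_update:
  assumes \<pi>: "\<pi> permutes {1..n}" and t: "t \<in> {1..n}" and "A \<in> sets (observed_info I (t - 1))"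
    and "X(\<pi> t := x) \<in> space (value_space I)" and "X(\<pi> t := y) \<in> space (value_space I)"
  shows "(\<pi>, X(\<pi> t := x), U) \<in> A \<longleftrightarrow> (\<pi>, X(\<pi> t := y), U) \<in> A"
proof -
  obtain B where A: "A = (\<lambda>\<omega>. \<lambda>s\<in>{1..min (t - 1) n}. observation \<omega> s) -` B \<inter> space (outcome_space I)"
    using past_event_vimage[OF assms(3)] by metis
  have "\<pi> s \<noteq> \<pi> t" if "s \<in> {1..min (t - 1) n}" for s
    using that t permutes_inj[OF \<pi>] by (auto dest!: injD)
  then have "(\<lambda>s\<in>{1..min (t - 1) n}. observation (\<pi>, X(\<pi> t := x), U) s)
      = (\<lambda>s\<in>{1..min (t - 1) n}. observation (\<pi>, X(\<pi> t := y), U) s)"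
    by (intro restrict_ext) auto
  then show ?thesis
    using assms(4,5) by (simp only: A vimage_eq Int_iff space_outcome_space space_pair_measure
        mem_Times_iff fst_conv snd_conv)
qed

text \<open>Integrating out the value revealed at time \<open>t\<close> first: the past event does not depend on it.\<close>

lemma
  fixes h :: "real \<Rightarrow> real"
  assumes \<pi>: "\<pi> permutes {1..n}" and t: "t \<in> {1..n}" and A: "A \<in> sets (observed_info I (t - 1))"
    and h [measurable]: "h \<in> borel_measurable borel" and bounded: "\<And>x. \<bar>h x\<bar> \<le> C"
    and centered: "(\<integral>x. h x \<partial>item (\<pi> t)) = 0"
  shows integrable_past_times: "integrable Q (\<lambda>z. indicator A (\<pi>, z) * h (fst z (\<pi> t)))"
    and integral_past_times_centered: "(\<integral>z. indicator A (\<pi>, z) * h (fst z (\<pi> t)) \<partial>Q) = 0"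
proof -
  let ?f = "\<lambda>z. indicator A (\<pi>, z) * h (fst z (\<pi> t))"
  let ?i = "\<pi> t" and ?J = "{1..n} - {\<pi> t}"
  have i: "?i \<in> {1..n}" using permutes_in[OF \<pi> t] .
  have C: "0 \<le> C" using bounded[of 0] by simp
  have bound: "norm (?f z) \<le> C" for z
    using bounded[of "fst z ?i"] C by (auto simp: indicator_def)
  have [measurable]: "(\<lambda>z. fst z ?i) \<in> borel_measurable Q" using i by measurable
  have meas: "?f \<in> borel_measurable Q"
  proof -
    have [measurable]: "{z \<in> space Q. (\<pi>, z) \<in> A} \<in> sets Q"
      by (rule past_event_slice[OF \<pi> A])
    have "(\<lambda>z. indicator {z \<in> space Q. (\<pi>, z) \<in> A} z * h (fst z ?i)) \<in> borel_measurable Q"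
      by (intro borel_measurable_times borel_measurable_indicator measurable_compose[OF _ h]) measurable
    then show ?thesis
      by (rule measurable_cong[THEN iffD1, rotated]) (auto simp: indicator_def)
  qed
  show int: "integrable Q ?f"
    using bound by (intro Q.P.integrable_const_bound[where B = C] meas) auto
  have inner: "(\<integral>X. ?f (X, U) \<partial>value_space I) = 0" if U: "U \<in> space (seed_space n)" for U
  proof -
    have ins: "insert ?i ?J = {1..n}" using i by auto
    have "integrable (value_space I) (\<lambda>X. ?f (X, U))"
      using bound measurable_compose[OF measurable_Pair2'[OF U] meas]
      by (intro V.integrable_const_bound[where B = C]) auto
    then have "(\<integral>X. ?f (X, U) \<partial>value_space I)
        = (\<integral>X. \<integral>y. ?f (X(?i := y), U) \<partial>item ?i \<partial>PiM ?J item)"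
      using item.product_integral_insert[of ?J ?i "\<lambda>X. ?f (X, U)"]
      unfolding value_space_item ins by simp
    also have "\<dots> = (\<integral>X. 0 \<partial>PiM ?J item)"
    proof (rule Bochner_Integration.integral_cong[OF refl])
      fix X assume X: "X \<in> space (PiM ?J item)"
      have sp: "X(?i := y) \<in> space (value_space I)" for y
        using X i by (auto simp: space_value_space[OF inst] space_PiM PiE_def extensional_def)
      \<comment> \<open>The indicator is constant in \<open>y\<close>, so it may be frozen at an
        arbitrary value, here 0, and only the centered factor is integrated.\<close>
      have "(\<integral>y. ?f (X(?i := y), U) \<partial>item ?i) = (\<integral>y. indicator A (\<pi>, X(?i := 0), U) * h y \<partial>item ?i)"
        using past_event_update[OF \<pi> t A sp sp]
        by (intro Bochner_Integration.integral_cong) (auto simp: indicator_def)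
      then show "(\<integral>y. ?f (X(?i := y), U) \<partial>item ?i) = 0" using centered by simp
    qed
    finally show ?thesis by simp
  qed
  have "(\<integral>z. ?f z \<partial>Q) = (\<integral>U. \<integral>X. ?f (X, U) \<partial>value_space I \<partial>seed_space n)"
    using Q.integral_snd[of "\<lambda>X U. ?f (X, U)"] int by (simp add: case_prod_beta')
  also have "\<dots> = (\<integral>U. 0 \<partial>seed_space n)"
    by (rule Bochner_Integration.integral_cong[OF refl inner])
  finally show "(\<integral>z. ?f z \<partial>Q) = 0" by simp
qed

end

section \<open>The hard instances\<close>

text \<open>A Riemann sum with right endpoints of a decreasing function is at most its integral.
  \<open>F\<close> is an antiderivative up to sign, with \<open>F 0 = b\<^sup>2 / 2\<close>; the
  summand \<open>j = 0\<close> accounts for the extra \<open>b\<close>.\<close>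

lemma sum_pos_part_le:
  fixes b :: real and k :: nat
  assumes "0 \<le> b" and k: "0 < k"
  shows "(\<Sum>j\<le>k. max 0 (b - real j / k)) \<le> b + k * b\<^sup>2 / 2"
proof -
  define F where "F s = (max 0 (b - s))\<^sup>2 / 2" for s :: real
  have step: "d * max 0 (b - (s + d)) \<le> F s - F (s + d)" if "0 \<le> d" for s d
  proof (cases "b \<le> s + d")
    case True
    then show ?thesis by (simp add: F_def)
  next
    case False
    then have "F s - F (s + d) = d * (b - (s + d)) + d\<^sup>2 / 2"
      using that by (simp add: F_def max_def power2_eq_square field_simps)
    then show ?thesis using False by simp
  qed
  have "(\<Sum>j\<le>m. max 0 (b - real j / k)) \<le> b + k * (F 0 - F (m / k))" for m :: nat
  proof (induction m)
    case 0
    then show ?case using assms by simp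
  next
    case (Suc m)
    have "1 / k * max 0 (b - (m / k + 1 / k)) \<le> F (m / k) - F (m / k + 1 / k)"
      by (rule step) simp
    moreover have "real (Suc m) / k = m / k + 1 / k" by (simp add: add_divide_distrib)
    ultimately have "max 0 (b - Suc m / k) \<le> k * (F (m / k) - F (Suc m / k))"
      using k by (simp add: divide_le_eq mult.commute)
    then show ?case using Suc by (simp add: algebra_simps)
  qed
  from this[of k] have "(\<Sum>j\<le>k. max 0 (b - real j / k)) \<le> b + k * (F 0 - F 1)"
    using k by simp
  also have "\<dots> \<le> b + k * F 0" by (simp add: F_def algebra_simps)
  finally show ?thesis using assms(1) by (simp add: F_def)
qed

text \<open>The average of the two competing payoffs over the arrival time \<open>j\<close> of the
  constant item. Counting the rare items still to come, \<open>k + 1 - j\<close>, instead of those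
  already seen turns the advantage of the first payoff into \<open>b - (k + 1 - j) / k\<close>, with
  \<open>b = (1 - \<gamma>) * a\<close>.\<close>

lemma sum_arrival_payoff_le:
  fixes a \<gamma> :: real and k :: nat
  assumes a: "0 \<le> a" and \<gamma>: "\<gamma> \<le> 1" and k: "0 < k"
  shows "(\<Sum>j\<in>{1..k + 1}. max ((real j - 1) / k + a) (1 + \<gamma> * a)) / (k + 1)
    \<le> 1 + \<gamma> * a + ((1 - \<gamma>) * a)\<^sup>2 / 2 + (1 - \<gamma>) * a / (k + 1)"
proof -
  define b where "b = (1 - \<gamma>) * a"
  have b: "0 \<le> b" using a \<gamma> by (simp add: b_def)
  have "(\<Sum>j\<in>{1..k + 1}. max ((real j - 1) / k + a) (1 + \<gamma> * a))
      = (\<Sum>j\<le>k. 1 + \<gamma> * a + max 0 (b - real j / k))"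
  proof (rule sum.reindex_bij_witness[of _ "\<lambda>j. k + 1 - j" "\<lambda>j. k + 1 - j"])
    fix j assume j: "j \<in> {1..k + 1}"
    then have "real (k + 1 - j) / k = 1 - (real j - 1) / k"
      using k by (auto simp: field_simps of_nat_diff)
    then show "1 + \<gamma> * a + max 0 (b - real (k + 1 - j) / k) = max ((real j - 1) / k + a) (1 + \<gamma> * a)"
      by (simp add: b_def max_def algebra_simps)
  qed auto
  also have "\<dots> = (k + 1) * (1 + \<gamma> * a) + (\<Sum>j\<le>k. max 0 (b - real j / k))"
    by (simp add: sum.distrib)
  also have "\<dots> \<le> (k + 1) * (1 + \<gamma> * a) + (b + k * b\<^sup>2 / 2)"
    by (intro add_left_mono sum_pos_part_le b k)
  also have "\<dots> \<le> (k + 1) * (1 + \<gamma> * a + b\<^sup>2 / 2 + b / (k + 1))"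
  proof -
    have "(k + 1) * (1 + \<gamma> * a + b\<^sup>2 / 2 + b / (k + 1))
        = (k + 1) * (1 + \<gamma> * a) + (k + 1) * (b\<^sup>2 / 2) + (k + 1) * (b / (k + 1))"
      by (simp only: distrib_left)
    moreover have "(k + 1) * (b / (k + 1)) = b" by simp
    moreover have "(k + 1) * (b\<^sup>2 / 2) = real k * b\<^sup>2 / 2 + b\<^sup>2 / 2"
      by (simp add: distrib_right)
    moreover have "0 \<le> b\<^sup>2 / 2" by simp
    ultimately show ?thesis by linarith
  qed
  finally show ?thesis by (simp add: b_def divide_le_eq mult.commute)
qed

section \<open>The rare items and the instances built from them\<close>

definition rare_dist :: "nat \<Rightarrow> real measure" where
  "rare_dist k = distr (measure_pmf (bernoulli_pmf (1 / (real k)\<^sup>2))) borel (\<lambda>b. if b then real k else 0)"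

text \<open>The constant item has number \<open>k + 1\<close>, so under the order
  \<open>\<pi>\<close> it arrives at time \<open>inv \<pi> (k + 1)\<close>.\<close>

definition hard_instance :: "nat \<Rightarrow> real \<Rightarrow> prophet_inst" where
  "hard_instance k a = replicate k (rare_dist k) @ [return borel a]"

lemma prob_space_rare_dist: "prob_space (rare_dist k)"
  unfolding rare_dist_def by (intro prob_space.prob_space_distr prob_space_measure_pmf) simp

lemma sets_rare_dist: "sets (rare_dist k) = sets borel"
  by (simp add: rare_dist_def)

lemma AE_rare_dist: "AE x in rare_dist k. x = 0 \<or> x = real k"
  unfolding rare_dist_def by (subst AE_distr_iff) auto

lemma integrable_rare_dist:
  "h \<in> borel_measurable borel \<Longrightarrow> integrable (rare_dist k) (h :: real \<Rightarrow> real)"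
  unfolding rare_dist_def
  by (subst integrable_distr_eq) (auto intro: integrable_measure_pmf_finite)

lemma integral_rare_dist:
  assumes "h \<in> borel_measurable borel" and "0 < k"
  shows "(\<integral>x. h x \<partial>rare_dist k) = h (real k) / (real k)\<^sup>2 + h 0 * (1 - 1 / (real k)\<^sup>2)"
  using assms by (simp add: rare_dist_def integral_distr)

lemma prophet_instance_hard:
  assumes "0 \<le> a"
  shows "prophet_instance (hard_instance k a)"
  unfolding prophet_instance_def
proof (intro conjI[of "_ \<noteq> []"] ballI)
  show "hard_instance k a \<noteq> []" by (simp add: hard_instance_def)
  fix F assume "F \<in> set (hard_instance k a)"
  then consider "F = rare_dist k" | "F = return borel a"
    by (auto simp: hard_instance_def split: if_splits)
  then show "prob_space F \<and> sets F = sets borel \<and> (AE x in F. 0 \<le> x) \<and> integrable F (\<lambda>x. x)"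
  proof cases
    case 1
    have "AE x in rare_dist k. 0 \<le> x"
      using AE_rare_dist by eventually_elim auto
    then show ?thesis
      unfolding 1 by (intro conjI prob_space_rare_dist sets_rare_dist integrable_rare_dist) simp_all
  next
    case 2
    interpret R: prob_space "return borel a :: real measure" by (rule prob_space_return) simp
    have "AE x in return borel a. norm x \<le> a" "AE x in return borel a. 0 \<le> x"
      using assms by (simp_all add: AE_return)
    then show ?thesis
      unfolding 2 by (intro conjI R.prob_space_axioms R.integrable_const_bound[of _ a]) simp_all
  qed
qed

section \<open>Expected maximum and expected reward on a hard instance\<close>

locale hard = prophet "hard_instance k a" for k :: nat and a :: real +
  assumes k: "0 < k" and a: "0 \<le> a"
begin

lemma length_hard [simp]: "n = k + 1"
  by (simp add: hard_instance_def)

lemma item_rare: "i \<in> {1..k} \<Longrightarrow> item i = rare_dist k"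
  unfolding item_def by (auto simp: hard_instance_def nth_append One_nat_def)

lemma item_last: "item (k + 1) = return borel a"
  unfolding item_def by (auto simp: hard_instance_def nth_append One_nat_def)

lemma AE_hard_values:
  "AE X in value_space (hard_instance k a). (\<forall>i\<in>{1..k}. X i = 0 \<or> X i = real k) \<and> X (k + 1) = a"
proof -
  have "AE X in value_space (hard_instance k a). \<forall>i\<in>{1..n}.
      (if i \<le> k then X i = 0 \<or> X i = real k else X i = a)"
  proof (rule AE_values)
    fix i assume i: "i \<in> {1..n}"
    show "AE x in item i. if i \<le> k then x = 0 \<or> x = real k else x = a"
    proof (cases "i \<le> k")
      case True
      then have "item i = rare_dist k" using i by (intro item_rare) auto
      with True show ?thesis by (simp only: if_True) (rule AE_rare_dist)
    next
      case False
      then have "i = k + 1" using i by simp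
      then show ?thesis using False by (simp only: item_last if_False) (simp add: AE_return)
    qed
  qed
  then show ?thesis by eventually_elim (auto dest: bspec[of _ _ "k + 1"])
qed

text \<open>On the event \<open>Z\<close> that all rare items vanish the maximum is at least
  \<open>a\<close>, and off it at least \<open>k\<close>. The probability of \<open>Z\<close> is at
  most \<open>k / (k + 1)\<close>, and \<open>k - (k - a) * (k / (k + 1))\<close> is the
  bound.\<close>

lemma expected_max_ge:
  assumes "a \<le> k"
  shows "(1 + a) * k / (k + 1) \<le> expected_max (hard_instance k a)"
proof -
  interpret fin: finite_product_prob_space item "{1..n}" by standard simp
  let ?V = "value_space (hard_instance k a)"
  define B where "B i = (if i \<le> k then {0} else UNIV :: real set)" for i :: nat
  define Z where "Z = PiE {1..n} B"
  have Z: "Z \<in> sets ?V"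
    unfolding Z_def value_space_item by (intro sets_PiM_I_finite) (auto simp: B_def sets_item)
  have m0: "measure (rare_dist k) {0} = 1 - 1 / (real k)\<^sup>2"
  proof -
    have "measure (rare_dist k) {0} = (\<integral>x. indicator {0} x \<partial>rare_dist k)"
      by (simp add: sets_rare_dist)
    also have "\<dots> = 1 - 1 / (real k)\<^sup>2"
      using k by (subst integral_rare_dist) auto
    finally show ?thesis .
  qed
  have "measure ?V Z = (\<Prod>i\<in>{1..n}. measure (item i) (B i))"
    unfolding Z_def value_space_item
    by (rule fin.finite_measure_PiM_emb) (auto simp: B_def sets_item)
  also have "\<dots> = (\<Prod>i\<in>{1..k}. measure (item i) (B i)) * measure (item (k + 1)) (B (k + 1))"
    unfolding length_hard Suc_eq_plus1[symmetric] by simp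
  also have "\<dots> = (1 - 1 / (real k)\<^sup>2) ^ k"
    using item.M.prob_space[of "k + 1"] by (simp add: B_def item_rare m0)
  also have "\<dots> \<le> k / (k + 1)"
  proof -
    let ?x = "1 / (real k)\<^sup>2"
    have x: "0 \<le> ?x" "?x \<le> 1" using k by (auto simp: divide_le_eq_1)
    \<comment> \<open>Bernoulli gives a lower bound for \<open>(1 + ?x) ^ k\<close>; since
      \<open>(1 - ?x) * (1 + ?x) \<le> 1\<close>, this becomes an upper bound for
      \<open>(1 - ?x) ^ k\<close>.\<close>
    have "(1 - ?x) ^ k * (1 + k * ?x) \<le> (1 - ?x) ^ k * (1 + ?x) ^ k"
      using x by (intro mult_left_mono Bernoulli_inequality) (smt (verit) zero_le_power)+
    also have "\<dots> = (1 - ?x\<^sup>2) ^ k"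
      by (simp add: power_mult_distrib[symmetric] algebra_simps power2_eq_square)
    also have "\<dots> \<le> 1" using x by (intro power_le_one) (auto simp: power_le_one)
    also have "1 + k * ?x = (k + 1) / k" using k by (simp add: field_simps power2_eq_square)
    finally show ?thesis using k by (simp add: field_simps)
  qed
  finally have PZ: "measure ?V Z \<le> k / (k + 1)" .
  have iZ: "integrable ?V (\<lambda>X. (k - a) * indicator Z X)"
    by (intro integrable_mult_right integrable_real_indicator Z) (simp add: less_top[symmetric])
  have "(1 + a) * k / (k + 1) = k - (k - a) * (k / (k + 1))"
    by (simp add: field_simps)
  also have "\<dots> \<le> k - (k - a) * measure ?V Z"
    using PZ assms by (intro diff_left_mono mult_left_mono) auto
  also have "\<dots> = (\<integral>X. k - (k - a) * indicator Z X \<partial>?V)"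
    by (subst Bochner_Integration.integral_diff[OF V.integrable_const iZ])
      (use Z in \<open>simp add: V.prob_space\<close>)
  also have "\<dots> \<le> expected_max (hard_instance k a)"
    unfolding expected_max_def
  proof (rule integral_mono_AE)
    show "AE X in ?V. k - (k - a) * indicator Z X \<le> max_value (hard_instance k a) X"
      using AE_hard_values AE_space
    proof eventually_elim
      case (elim X)
      show ?case
      proof (cases "X \<in> Z")
        case True
        then show ?thesis using elim max_value_ge[of "k + 1" X] by simp
      next
        case False
        then have "\<exists>i\<in>{1..k}. X i \<noteq> 0"
          using elim(2) unfolding space_value_space[OF inst] Z_def PiE_def B_def
          by (auto split: if_splits)
        then obtain i where i: "i \<in> {1..k}" "X i \<noteq> 0" by blast
        then have "X i = k" using elim(1) by auto
        then show ?thesis using False max_value_ge[of i X] i by simp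
      qed
    qed
  qed (intro Bochner_Integration.integrable_diff V.integrable_const iZ integrable_max_value_value_space)+
  finally show ?thesis .
qed

text \<open>The sum on the right is the martingale part: each rare item looked at is charged its
  expectation \<open>1 / k\<close>. The charges and the share of the constant item together cannot
  exceed the final maximum, whatever the stopping time.\<close>

lemma reward_le_path:
  fixes z :: "(nat \<Rightarrow> real) \<times> (nat \<Rightarrow> real)" and \<gamma> :: real
  assumes \<pi>: "\<pi> permutes {1..n}" and \<tau>: "\<tau> \<in> {1..n + 1}" and \<gamma>: "0 \<le> \<gamma>" "\<gamma> \<le> 1"
    and rare: "\<forall>i\<in>{1..k}. fst z i = 0 \<or> fst z i = real k" and last: "fst z (k + 1) = a"
  shows "reward \<gamma> (hard_instance k a) (\<pi>, z) \<tau>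
    \<le> (\<Sum>t\<in>{t\<in>{1..n}. \<pi> t \<noteq> k + 1}. of_bool (t \<le> \<tau>) * (real k * of_bool (fst z (\<pi> t) = real k) - 1 / k))
      + max ((real (inv \<pi> (k + 1)) - 1) / k + a) (1 + \<gamma> * a)"
proof -
  let ?R = "reward \<gamma> (hard_instance k a) (\<pi>, z) \<tau>"
  define T where "T = inv \<pi> (k + 1)"
  have \<pi>T: "\<pi> T = k + 1" by (simp add: T_def permutes_inverses[OF \<pi>])
  have T: "T \<in> {1..n}" unfolding T_def by (rule permutes_in[OF permutes_inv[OF \<pi>]]) simp
  have eq_T: "\<pi> t = k + 1 \<longleftrightarrow> t = T" for t
    using permutes_inv_eq[OF \<pi>, of "k + 1" t] by (auto simp: T_def)
  define J where "J = {t\<in>{1..n}. \<pi> t \<noteq> k + 1}"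
  \<comment> \<open>\<open>c\<close> is the total of the rare values seen up to
    \<open>\<tau>\<close>, and \<open>d\<close> the share of the constant item: in full when the
    rule stops there, discounted when it came earlier.\<close>
  define c where "c = (\<Sum>t\<in>J. of_bool (t \<le> \<tau>) * (real k * of_bool (fst z (\<pi> t) = real k)))"
  define d where "d = a * of_bool (\<tau> = T) + \<gamma> * a * of_bool (T < \<tau>)"
  have c0: "0 \<le> c" unfolding c_def by (intro sum_nonneg) simp
  have d0: "0 \<le> d" using a \<gamma> by (simp add: d_def)
  have val: "fst z (\<pi> s) \<le> c \<and> 0 \<le> fst z (\<pi> s)" if s: "s \<in> {1..n}" "s \<le> \<tau>" "s \<noteq> T" for s
  proof -
    have sJ: "s \<in> J" using s eq_T by (simp add: J_def)
    have "\<pi> s \<in> {1..k}" using permutes_in[OF \<pi> s(1)] s(3) eq_T[of s] by auto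
    then have "fst z (\<pi> s) = 0 \<or> fst z (\<pi> s) = real k" using rare by blast
    moreover have "of_bool (s \<le> \<tau>) * (real k * of_bool (fst z (\<pi> s) = real k)) \<le> c"
      unfolding c_def using sJ by (intro member_le_sum) (auto simp: J_def)
    ultimately show ?thesis using s c0 by auto
  qed
  have valT: "fst z (\<pi> T) = a" using \<pi>T last by simp
  have now: "fst z (\<pi> \<tau>) \<le> c + d" if "\<tau> \<le> n"
    using val[of \<tau>] valT that \<tau> c0 d0 by (cases "\<tau> = T") (auto simp: d_def)
  have earlier: "\<gamma> * fst z (\<pi> s) \<le> c + d" if s: "s \<in> {1..n}" "s < \<tau>" for s
  proof (cases "s = T")
    case True
    then show ?thesis using valT s c0 by (simp add: d_def)
  next
    case False
    then have "fst z (\<pi> s) \<le> c" "0 \<le> fst z (\<pi> s)" using val[of s] s by auto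
    then have "\<gamma> * fst z (\<pi> s) \<le> c" using \<gamma> mult_left_le_one_le[of "fst z (\<pi> s)" \<gamma>] by linarith
    then show ?thesis using d0 by simp
  qed
  have R: "?R \<le> c + d"
  proof (cases "\<tau> \<le> n")
    case True
    have "revealed (\<pi>, z) s = fst z (\<pi> s)" for s by (cases z) simp
    then show ?thesis using True now earlier by (auto simp: reward_def)
  next
    case False
    obtain i where i: "i \<in> {1..n}" "max_value (hard_instance k a) (fst z) = fst z i"
      using max_value_in by blast
    have "inv \<pi> i \<in> {1..n}" by (rule permutes_in[OF permutes_inv[OF \<pi>] i(1)])
    then have "\<gamma> * fst z (\<pi> (inv \<pi> i)) \<le> c + d" using False by (intro earlier) auto
    then show ?thesis using False i(2) by (simp add: reward_def permutes_inverses[OF \<pi>])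
  qed
  have "(\<Sum>t\<in>J. of_bool (t \<le> \<tau>) * (1 / real k)) + d \<le> max ((real T - 1) / k + a) (1 + \<gamma> * a)"
  proof -
    have J: "J = {1..n} - {T}" unfolding J_def eq_T by blast
    have "(\<Sum>t\<in>J. of_bool (t \<le> \<tau>) * (1 / real k)) = (\<Sum>t\<in>J. if t \<le> \<tau> then 1 / real k else 0)"
      by (intro sum.cong) auto
    also have "\<dots> = (\<Sum>t\<in>{t\<in>J. t \<le> \<tau>}. 1 / real k)"
      by (rule sum.inter_filter[symmetric]) (simp add: J_def)
    finally have cnt: "(\<Sum>t\<in>J. of_bool (t \<le> \<tau>) * (1 / real k)) = card {t\<in>J. t \<le> \<tau>} / k"
      by simp
    define C where "C = card {t\<in>J. t \<le> \<tau>}"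
    \<comment> \<open>Stopping no later than \<open>T\<close> means at most \<open>T - 1\<close>
      rare items seen and a share of at most \<open>a\<close>; stopping later means at most
      \<open>k\<close> rare items and the share \<open>\<gamma> * a\<close>.\<close>
    have "C / k + d \<le> (real T - 1) / k + a \<or> C / k + d \<le> 1 + \<gamma> * a"
    proof (cases "\<tau> \<le> T")
      case True
      then have "{t\<in>J. t \<le> \<tau>} \<subseteq> {1..<T}" unfolding J by auto
      from card_mono[OF _ this] have "C \<le> T - 1" by (simp add: C_def)
      then have "real C \<le> real T - 1" using T by auto
      then have "C / k \<le> (real T - 1) / k" by (rule divide_right_mono) simp
      moreover have "d \<le> a" using True a by (simp add: d_def)
      ultimately show ?thesis by linarith
    next
      case False
      have "C \<le> card J" unfolding C_def by (intro card_mono) (auto simp: J)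
      also have "card J = k" unfolding J using T by simp
      finally have "C / k \<le> 1" using k by (simp add: divide_le_eq_1)
      moreover have "d = \<gamma> * a" using False by (simp add: d_def)
      ultimately show ?thesis by linarith
    qed
    then show ?thesis unfolding cnt C_def[symmetric] le_max_iff_disj .
  qed
  moreover have "r \<le> u - s + m" if "r \<le> u + w" "s + w \<le> m" for r u w s m :: real
    using that by linarith
  ultimately have "?R \<le> c - (\<Sum>t\<in>J. of_bool (t \<le> \<tau>) * (1 / real k)) + max ((real T - 1) / k + a) (1 + \<gamma> * a)"
    using R by blast
  also have "c - (\<Sum>t\<in>J. of_bool (t \<le> \<tau>) * (1 / real k)) =
      (\<Sum>t\<in>J. of_bool (t \<le> \<tau>) * (real k * of_bool (fst z (\<pi> t) = real k) - 1 / k))"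
    by (simp only: c_def right_diff_distrib sum_subtractf)
  finally show ?thesis unfolding J_def T_def .
qed

text \<open>For each order the martingale part integrates to zero, which leaves the payoff
  \<open>v\<close> at the arrival time of the constant item, and that time is uniform on
  \<open>{1..n}\<close>.\<close>

lemma expected_reward_le:
  assumes alg: "online_algorithm ALG" and \<gamma>: "0 \<le> \<gamma>" "\<gamma> \<le> 1"
  shows "expected_reward \<gamma> ALG (hard_instance k a)
    \<le> 1 + \<gamma> * a + ((1 - \<gamma>) * a)\<^sup>2 / 2 + (1 - \<gamma>) * a / (k + 1)"
proof -
  let ?I = "hard_instance k a" and ?\<Omega> = "outcome_space (hard_instance k a)"
  let ?\<tau> = "ALG ?I"
  have st: "stopping_time (observed_info ?I) ?\<tau>"
    and range: "\<And>\<omega>. \<omega> \<in> space ?\<Omega> \<Longrightarrow> ?\<tau> \<omega> \<in> {1..n + 1}"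
    using alg inst by (auto simp: online_algorithm_def)
  define A where "A t = {\<omega> \<in> space ?\<Omega>. t \<le> ?\<tau> \<omega>}" for t
  \<comment> \<open>On the two values of a rare item this is \<open>x - 1 / k\<close>; written with
    \<open>of_bool\<close> it is bounded on the whole line.\<close>
  define h where "h x = real k * of_bool (x = real k) - 1 / k" for x :: real
  have h [measurable]: "h \<in> borel_measurable borel" unfolding h_def by measurable
  have h_bound: "\<bar>h x\<bar> \<le> k + 1 / k" for x
  proof -
    have "0 \<le> 1 / real k" by simp
    then show ?thesis by (cases "x = real k") (auto simp: h_def abs_le_iff)
  qed
  have h_int: "(\<integral>x. h x \<partial>rare_dist k) = 0"
    using k by (subst integral_rare_dist[OF h]) (auto simp: h_def field_simps power2_eq_square)
  \<comment> \<open>The event \<open>t \<le> ?\<tau> \<omega>\<close> is the complement of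
    \<open>?\<tau> \<omega> \<le> t - 1\<close>, hence already decided before the value at time
    \<open>t\<close> is revealed.\<close>
  have A: "A t \<in> sets (observed_info ?I (t - 1))" if "1 \<le> t" for t
  proof -
    have "Measurable.pred (observed_info ?I (t - 1)) (\<lambda>\<omega>. \<not> ?\<tau> \<omega> \<le> t - 1)"
      using st by (intro pred_intros_logic) (auto simp: stopping_time_def)
    moreover have "A t = {\<omega> \<in> space (observed_info ?I (t - 1)). \<not> ?\<tau> \<omega> \<le> t - 1}"
      using that by (auto simp: A_def observed_info_def)
    ultimately show ?thesis by (simp add: pred_def)
  qed
  define v where "v j = max ((real j - 1) / k + a) (1 + \<gamma> * a)" for j :: nat
  define g where "g = (\<lambda>(\<pi>, z). (\<Sum>t\<in>{t\<in>{1..n}. \<pi> t \<noteq> k + 1}. indicator (A t) (\<pi>, z) * h (fst z (\<pi> t)))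
      + v (inv \<pi> (k + 1)))"
  have summand: "integrable Q (\<lambda>z. indicator (A t) (\<pi>, z) * h (fst z (\<pi> t)))"
    "(\<integral>z. indicator (A t) (\<pi>, z) * h (fst z (\<pi> t)) \<partial>Q) = 0"
    if \<pi>: "\<pi> permutes {1..n}" and t: "t \<in> {t\<in>{1..n}. \<pi> t \<noteq> k + 1}" for \<pi> t
  proof -
    have t': "t \<in> {1..n}" "1 \<le> t" using t by auto
    have "\<pi> t \<in> {1..k}" using permutes_in[OF \<pi> t'(1)] t by auto
    then have "(\<integral>x. h x \<partial>item (\<pi> t)) = 0" using h_int by (simp add: item_rare)
    from integrable_past_times[OF \<pi> t'(1) A[OF t'(2)] h h_bound this]
      integral_past_times_centered[OF \<pi> t'(1) A[OF t'(2)] h h_bound this]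
    show "integrable Q (\<lambda>z. indicator (A t) (\<pi>, z) * h (fst z (\<pi> t)))"
      "(\<integral>z. indicator (A t) (\<pi>, z) * h (fst z (\<pi> t)) \<partial>Q) = 0" .
  qed
  have g: "integrable Q (\<lambda>z. g (\<pi>, z))" "(\<integral>z. g (\<pi>, z) \<partial>Q) = v (inv \<pi> (k + 1))"
    if \<pi>: "\<pi> permutes {1..n}" for \<pi>
  proof -
    have i: "integrable Q (\<lambda>z. \<Sum>t\<in>{t\<in>{1..n}. \<pi> t \<noteq> k + 1}. indicator (A t) (\<pi>, z) * h (fst z (\<pi> t)))"
      by (intro Bochner_Integration.integrable_sum summand[OF \<pi>])
    show "integrable Q (\<lambda>z. g (\<pi>, z))"
      unfolding g_def prod.case by (intro Bochner_Integration.integrable_add i Q.P.integrable_const)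
    have "(\<integral>z. (\<Sum>t\<in>{t\<in>{1..n}. \<pi> t \<noteq> k + 1}. indicator (A t) (\<pi>, z) * h (fst z (\<pi> t))) \<partial>Q) = 0"
      by (subst Bochner_Integration.integral_sum[OF summand(1)[OF \<pi>]], assumption)
        (intro sum.neutral ballI summand(2)[OF \<pi>])
    then show "(\<integral>z. g (\<pi>, z) \<partial>Q) = v (inv \<pi> (k + 1))"
      unfolding g_def prod.case
      by (simp only: Bochner_Integration.integral_add[OF i Q.P.integrable_const]
          lebesgue_integral_const Q.P.prob_space scaleR_one add_0)
  qed
  \<comment> \<open>The lower bound on the reward makes \<open>g\<close> nonnegative almost
    everywhere. The integrals then compare for an arbitrary \<open>ALG\<close>, as a non-integrable
    reward would have integral 0 by convention.\<close>
  have AE: "AE \<omega> in ?\<Omega>. reward \<gamma> ?I \<omega> (?\<tau> \<omega>) \<le> g \<omega> \<and> 0 \<le> reward \<gamma> ?I \<omega> (?\<tau> \<omega>)"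
    using AE_outcome_space[OF AE_Q[OF AE_hard_values]] AE_space
  proof eventually_elim
    case (elim \<omega>)
    obtain \<pi> z where \<omega>: "\<omega> = (\<pi>, z)" by (cases \<omega>)
    have \<pi>: "\<pi> permutes {1..n}" using elim(2) by (simp add: \<omega> space_outcome_space)
    have vals: "\<forall>i\<in>{1..k}. fst z i = 0 \<or> fst z i = real k" "fst z (k + 1) = a"
      using elim(1) by (auto simp: \<omega>)
    have "reward \<gamma> ?I (\<pi>, z) (?\<tau> (\<pi>, z)) \<le> g (\<pi>, z)"
    proof -
      have "g (\<pi>, z) = (\<Sum>t\<in>{t\<in>{1..n}. \<pi> t \<noteq> k + 1}. of_bool (t \<le> ?\<tau> (\<pi>, z)) *
          (real k * of_bool (fst z (\<pi> t) = real k) - 1 / k)) + v (inv \<pi> (k + 1))"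
        using elim(2) by (simp add: g_def A_def h_def \<omega> indicator_def of_bool_def)
      then show ?thesis
        using reward_le_path[OF \<pi> range[OF elim(2)] \<gamma> vals] by (simp add: \<omega> v_def)
    qed
    moreover have "1 \<le> ?\<tau> (\<pi>, z)" using range[OF elim(2)] \<omega> by simp
    moreover obtain i where "i \<in> {1..n}" "reward \<gamma> ?I (\<pi>, z) (?\<tau> (\<pi>, z)) = fst z i \<or>
        reward \<gamma> ?I (\<pi>, z) (?\<tau> (\<pi>, z)) = \<gamma> * fst z i"
      using reward_in[OF \<pi> calculation(2)] by blast
    moreover have "0 \<le> fst z i"
    proof (cases "i = k + 1")
      case True
      then show ?thesis using vals a by simp
    next
      case False
      then have "i \<in> {1..k}" using \<open>i \<in> {1..n}\<close> by auto
      then have "fst z i = 0 \<or> fst z i = real k" using vals by blast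
      then show ?thesis by auto
    qed
    ultimately show ?case using \<gamma> by (auto simp: \<omega>)
  qed
  have "expected_reward \<gamma> ALG ?I \<le> (\<integral>\<omega>. g \<omega> \<partial>?\<Omega>)"
    unfolding expected_reward_def
    by (rule integral_mono_AE'[OF integrable_outcome_space[OF g(1)]])
      (use AE in \<open>auto elim: eventually_mono\<close>)
  also have "\<dots> = (\<Sum>\<pi>\<in>orders. \<integral>z. g (\<pi>, z) \<partial>Q) / fact n"
    by (rule integral_outcome_space[OF g(1)])
  also have "(\<Sum>\<pi>\<in>orders. \<integral>z. g (\<pi>, z) \<partial>Q) = (\<Sum>\<pi>\<in>orders. v (inv \<pi> (k + 1)))"
    by (rule sum.cong[OF refl], rule g(2)) (simp only: mem_Collect_eq)
  \<comment> \<open>The inverse of a uniform order is again uniform, so the arrival time of an item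
    may be replaced by the item at a fixed time.\<close>
  also have "(\<Sum>\<pi>\<in>orders. v (inv \<pi> (k + 1))) = (\<Sum>\<pi>\<in>orders. v (\<pi> (k + 1)))"
    by (rule sum_permutations_inverse[symmetric])
  also have "\<dots> / fact n = (\<Sum>j\<in>{1..n}. v j) / n"
    using sum_permutes_apply[of "{1..n}" "k + 1" v] by (simp add: field_simps del: fact_Suc)
  also have "\<dots> \<le> 1 + \<gamma> * a + ((1 - \<gamma>) * a)\<^sup>2 / 2 + (1 - \<gamma>) * a / (k + 1)"
    using sum_arrival_payoff_le[OF a \<gamma>(2) k] by (simp add: v_def add.commute)
  finally show ?thesis .
qed

end

section \<open>The limit of many rare items and the choice of the constant\<close>

lemma CR_le_hard:
  assumes alg: "online_algorithm ALG" and \<gamma>: "0 \<le> \<gamma>" "\<gamma> \<le> 1" and a: "0 \<le> a"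
  shows "CR \<gamma> ALG \<le> (1 + \<gamma> * a + ((1 - \<gamma>) * a)\<^sup>2 / 2) / (1 + a)"
proof -
  \<comment> \<open>The quotient of the bounds in \<open>expected_reward_le\<close> and
    \<open>expected_max_ge\<close>; its limit is the claimed bound.\<close>
  define u where "u k = (1 + \<gamma> * a + ((1 - \<gamma>) * a)\<^sup>2 / 2 + (1 - \<gamma>) * a / (real k + 1)) /
      ((1 + a) * real k / (real k + 1))" for k
  have "u \<longlonglongrightarrow> (1 + \<gamma> * a + ((1 - \<gamma>) * a)\<^sup>2 / 2 + 0) / ((1 + a) * 1)"
  proof -
    have "(\<lambda>k. (1 - \<gamma>) * a / (real k + 1)) \<longlonglongrightarrow> 0" by real_asymp
    moreover have "(\<lambda>k. (1 + a) * (real k / (real k + 1))) \<longlonglongrightarrow> (1 + a) * 1"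
      by (intro tendsto_intros) real_asymp
    ultimately show ?thesis
      unfolding u_def using a by (intro tendsto_intros) (auto simp: add_nonneg_eq_0_iff)
  qed
  moreover have "CR \<gamma> ALG \<le> u k" if large: "max 1 (nat \<lceil>a\<rceil>) \<le> k" for k
  proof -
    interpret hard k a
      using large a prophet_instance_hard[OF a, of k] by unfold_locales auto
    have ak: "a \<le> k" using large by linarith
    let ?I = "hard_instance k a"
    have lower: "0 < (1 + a) * k / (k + 1)" using a k by (simp add: add_nonneg_pos)
    have "CR \<gamma> ALG \<le> expected_reward \<gamma> ALG ?I / expected_max ?I"
      unfolding CR_def
    proof (rule cINF_lower)
      show "bdd_below ((\<lambda>I. expected_reward \<gamma> ALG I / expected_max I) ` {I. prophet_instance I \<and> 0 < expected_max I})"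
        using prophet.expected_reward_nonneg[OF prophet.intro alg \<gamma>(1)]
        by (intro bdd_belowI2[of _ 0]) auto
      show "?I \<in> {I. prophet_instance I \<and> 0 < expected_max I}"
        using inst expected_max_ge[OF ak] lower by auto
    qed
    also have "\<dots> \<le> u k"
      unfolding u_def using expected_max_ge[OF ak] lower expected_reward_le[OF alg \<gamma>]
        expected_reward_nonneg[OF alg \<gamma>(1)]
      by (intro frac_le) auto
    finally show ?thesis .
  qed
  ultimately show ?thesis
    using tendsto_lowerbound[OF _ eventually_sequentiallyI[of "max 1 (nat \<lceil>a\<rceil>)"], of u]
    by simp
qed

text \<open>\<open>a\<close> is the critical point of the quotient, characterised by
  \<open>(1 - \<gamma>) * (1 + a)\<^sup>2 = 3 - \<gamma>\<close>.\<close>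

lemma optimal_constant:
  fixes \<gamma> :: real
  assumes "0 \<le> \<gamma>" and "\<gamma> < 1"
  defines "a \<equiv> sqrt ((3 - \<gamma>) / (1 - \<gamma>)) - 1"
  shows "0 \<le> a"
    and "(1 + \<gamma> * a + ((1 - \<gamma>) * a)\<^sup>2 / 2) / (1 + a)
      = (1 - \<gamma>) powr (3/2) * (sqrt (3 - \<gamma>) - sqrt (1 - \<gamma>)) + \<gamma>"
proof -
  have "1 \<le> (3 - \<gamma>) / (1 - \<gamma>)" using assms by (simp add: le_divide_eq)
  then show a0: "0 \<le> a" by (simp add: a_def)
  have sq: "(1 + a)\<^sup>2 = (3 - \<gamma>) / (1 - \<gamma>)" using assms by (simp add: a_def)
  have root: "(1 - \<gamma>) * (1 + a)\<^sup>2 = 3 - \<gamma>" unfolding sq using assms by simp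
  \<comment> \<open>Vanishing of the derivative of the quotient: its value is then the derivative of
    the numerator divided by that of the denominator, which is 1.\<close>
  have "1 + \<gamma> * a + ((1 - \<gamma>) * a)\<^sup>2 / 2 = (\<gamma> + (1 - \<gamma>)\<^sup>2 * a) * (1 + a)"
  proof -
    have "(1 - \<gamma>) * ((1 - \<gamma>) * (1 + a)\<^sup>2) = (1 - \<gamma>) * (3 - \<gamma>)" by (simp only: root)
    then show ?thesis by (simp add: power2_eq_square field_simps)
  qed
  then have "(1 + \<gamma> * a + ((1 - \<gamma>) * a)\<^sup>2 / 2) / (1 + a) = \<gamma> + (1 - \<gamma>)\<^sup>2 * a"
    using a0 by simp
  also have "(1 - \<gamma>)\<^sup>2 * a = (1 - \<gamma>) powr (3/2) * (sqrt (3 - \<gamma>) - sqrt (1 - \<gamma>))"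
  proof -
    let ?s = "sqrt (1 - \<gamma>)"
    have s: "0 < ?s" "?s\<^sup>2 = 1 - \<gamma>" using assms by auto
    have "(1 - \<gamma>) powr (3/2) = (1 - \<gamma>) powr (1 + 1/2)" by simp
    also have "\<dots> = (1 - \<gamma>) * ?s"
      unfolding powr_add using assms by (simp add: powr_half_sqrt)
    finally have "(1 - \<gamma>) powr (3/2) = ?s\<^sup>2 * ?s" using s(2) by simp
    moreover have "a = sqrt (3 - \<gamma>) / ?s - 1" by (simp add: a_def real_sqrt_divide)
    moreover have "(1 - \<gamma>)\<^sup>2 = (?s\<^sup>2)\<^sup>2" using s(2) by simp
    moreover have "(x\<^sup>2)\<^sup>2 * (y / x - 1) = x\<^sup>2 * x * (y - x)" if "0 < x" for x y :: real
      using that by (simp add: field_simps power2_eq_square)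
    ultimately show ?thesis using s(1) by metis
  qed
  finally show "(1 + \<gamma> * a + ((1 - \<gamma>) * a)\<^sup>2 / 2) / (1 + a)
      = (1 - \<gamma>) powr (3/2) * (sqrt (3 - \<gamma>) - sqrt (1 - \<gamma>)) + \<gamma>" by simp
qed

theorem theorem3:
  fixes \<gamma> :: real
  assumes "0 \<le> \<gamma>" and "\<gamma> \<le> 1"
  shows "(\<forall>ALG. online_algorithm ALG \<longrightarrow>
            CR \<gamma> ALG \<le> (1 - \<gamma>) powr (3/2) * (sqrt (3 - \<gamma>) - sqrt (1 - \<gamma>)) + \<gamma>)
       \<and> (\<gamma> < 1 \<longrightarrow> (\<exists>!p. 0 < p \<and> p < 1 \<and> 1 - (1 - \<gamma>) * p = (1 - p) / (- ln p)))
       \<and> (\<forall>p. 0 < p \<and> p < 1 \<and> 1 - (1 - \<gamma>) * p = (1 - p) / (- ln p) \<longrightarrow>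
            (\<forall>I. prophet_instance I \<longrightarrow> (\<exists>\<theta> q. 0 \<le> q \<and> q \<le> 1 \<and> prob_max_below I \<theta> q = p)) \<and>
            (\<forall>\<theta> q. (\<forall>I. prophet_instance I \<longrightarrow>
                       0 \<le> q I \<and> q I \<le> 1 \<and> prob_max_below I (\<theta> I) (q I) = p) \<longrightarrow>
               1 - (1 - \<gamma>) * p \<le> CR \<gamma> (single_threshold \<theta> q)))"
proof (intro conjI allI impI; (elim conjE)?)
  fix ALG assume alg: "online_algorithm ALG"
  show "CR \<gamma> ALG \<le> (1 - \<gamma>) powr (3/2) * (sqrt (3 - \<gamma>) - sqrt (1 - \<gamma>)) + \<gamma>"
  proof (cases "\<gamma> = 1")
    \<comment> \<open>The optimal constant has no analogue here, but every \<open>a \<ge> 0\<close>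
      makes the bound equal to 1, for instance \<open>a = 1\<close>.\<close>
    case True
    then show ?thesis using CR_le_hard[OF alg assms, of 1] by simp
  next
    case False
    with assms have "\<gamma> < 1" by simp
    with CR_le_hard[OF alg assms] optimal_constant[OF assms(1)] show ?thesis by metis
  qed
next
  \<comment> \<open>For \<gamma> = 1 the equation reads \<open>- ln p = 1 - p\<close> and has no
    solution between 0 and 1, hence the restriction.\<close>
  assume "\<gamma> < 1"
  then show "\<exists>!p. 0 < p \<and> p < 1 \<and> 1 - (1 - \<gamma>) * p = (1 - p) / (- ln p)"
    using assms threshold_probability_unique[of "1 - \<gamma>"] by simp
next
  fix p :: real and I assume "0 < p" "p < 1" "prophet_instance I"
  then show "\<exists>\<theta> q. 0 \<le> q \<and> q \<le> 1 \<and> prob_max_below I \<theta> q = p"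
    using prophet.threshold_exists[OF prophet.intro] by blast
next
  fix p :: real and \<theta> q :: "prophet_inst \<Rightarrow> real"
  assume p: "0 < p" "p < 1" "1 - (1 - \<gamma>) * p = (1 - p) / (- ln p)"
    and thr: "\<forall>I. prophet_instance I \<longrightarrow> 0 \<le> q I \<and> q I \<le> 1 \<and> prob_max_below I (\<theta> I) (q I) = p"
  show "1 - (1 - \<gamma>) * p \<le> CR \<gamma> (single_threshold \<theta> q)"
    unfolding CR_def
  proof (rule cINF_greatest)
    interpret hard 1 1
      using prophet_instance_hard[of 1 1] by unfold_locales auto
    \<comment> \<open>The infimum ranges over a nonempty set: with \<open>k = 1\<close> and
      \<open>a = 1\<close> the expected maximum is at least 1.\<close>
    show "{I. prophet_instance I \<and> 0 < expected_max I} \<noteq> {}"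
      using inst expected_max_ge by fastforce
  next
    fix I assume "I \<in> {I. prophet_instance I \<and> 0 < expected_max I}"
    then have I: "prophet_instance I" "0 < expected_max I" by auto
    have "(1 - (1 - \<gamma>) * p) * expected_max I \<le> expected_reward \<gamma> (single_threshold \<theta> q) I"
      using thr I(1) by (intro prophet.threshold_expected_reward_ge assms p prophet.intro) auto
    then show "1 - (1 - \<gamma>) * p \<le> expected_reward \<gamma> (single_threshold \<theta> q) I / expected_max I"
      using I(2) by (simp add: pos_le_divide_eq)
  qed
qed

end
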